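(* Let $X$ be an $n$-dimensional affine variety, and let $Y$ be an algebraic variety admitting a surjective morphism $f: \mathbb{A}^n \to Y$. Then there exists a surjective morphism $\phi: X \to Y$ that factors as a composition of morphisms $X \to \mathbb{A}^n \to Y$.
   Context: All varieties are over an algebraically closed field $\mathbb{K}$ of characteristic zero, and $\mathbb{A}^n$ denotes affine $n$-space over $\mathbb{K}$. *)

theory Defs
  imports "HOL-Analysis.Abstract_Topology" "HOL-Computational_Algebra.Polynomial"
begin

section \<open>Spaces with functions\<close>

text \<open>
  Algebraic varieties over an algebraically closed field are treated in the classical way, as
  topological spaces carrying a sheaf of \<open>'k\<close>-valued functions that are locally isomorphic to
  affine algebraic sets.  The field \<^term>\<open>regular X U\<close> is the predicate of being a regular
  function on \<open>U\<close>; it is meaningful only for open \<open>U\<close>, and only the values of the function on \<open>U\<close>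
  matter (axiom \<open>regular_cong\<close>), so functions need not be extensional.
\<close>

record ('a, 'k) fun_space =
  top_of :: "'a topology"
  regular :: "'a set \<Rightarrow> ('a \<Rightarrow> 'k) \<Rightarrow> bool"

abbreviation points :: "('a, 'k) fun_space \<Rightarrow> 'a set" where
  "points X \<equiv> topspace (top_of X)"

locale space_with_functions =
  fixes X :: "('a, 'k::field) fun_space"
  assumes regular_cong:
      "\<lbrakk>openin (top_of X) U; regular X U f; \<And>x. x \<in> U \<Longrightarrow> f x = g x\<rbrakk> \<Longrightarrow> regular X U g"
    and regular_const: "openin (top_of X) U \<Longrightarrow> regular X U (\<lambda>_. c)"
    and regular_add:
      "\<lbrakk>openin (top_of X) U; regular X U f; regular X U g\<rbrakk> \<Longrightarrow> regular X U (\<lambda>x. f x + g x)"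
    and regular_mult:
      "\<lbrakk>openin (top_of X) U; regular X U f; regular X U g\<rbrakk> \<Longrightarrow> regular X U (\<lambda>x. f x * g x)"
    and regular_restrict:
      "\<lbrakk>openin (top_of X) U; openin (top_of X) V; V \<subseteq> U; regular X U f\<rbrakk> \<Longrightarrow> regular X V f"
    and regular_glue:
      "\<lbrakk>\<And>U. U \<in> \<U> \<Longrightarrow> openin (top_of X) U; \<And>U. U \<in> \<U> \<Longrightarrow> regular X U f\<rbrakk> \<Longrightarrow> regular X (\<Union>\<U>) f"

definition fun_morphism ::
    "('a, 'k) fun_space \<Rightarrow> ('b, 'k) fun_space \<Rightarrow> ('a \<Rightarrow> 'b) \<Rightarrow> bool" where
  "fun_morphism X Y \<phi> \<longleftrightarrow>
     continuous_map (top_of X) (top_of Y) \<phi> \<and>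
     (\<forall>V f. openin (top_of Y) V \<and> regular Y V f \<longrightarrow>
        regular X {x \<in> points X. \<phi> x \<in> V} (\<lambda>x. f (\<phi> x)))"

definition fun_isomorphic :: "('a, 'k) fun_space \<Rightarrow> ('b, 'k) fun_space \<Rightarrow> bool" where
  "fun_isomorphic X Y \<longleftrightarrow>
     (\<exists>\<phi> \<psi>. fun_morphism X Y \<phi> \<and> fun_morphism Y X \<psi> \<and>
        (\<forall>x\<in>points X. \<psi> (\<phi> x) = x) \<and> (\<forall>y\<in>points Y. \<phi> (\<psi> y) = y))"

text \<open>The induced structure on an open subset; open subsets of \<open>U\<close> are open in \<open>X\<close>.\<close>

definition open_subspace :: "('a, 'k) fun_space \<Rightarrow> 'a set \<Rightarrow> ('a, 'k) fun_space" where
  "open_subspace X U = X\<lparr>top_of := subtopology (top_of X) U\<rparr>"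


section \<open>Affine algebraic sets\<close>

definition affine_points :: "nat \<Rightarrow> (nat \<Rightarrow> 'k) set" where
  "affine_points n = {..<n} \<rightarrow>\<^sub>E UNIV"

text \<open>Polynomial functions in the coordinates \<open>x\<^sub>0, \<dots>, x\<^sub>n\<^sub>-\<^sub>1\<close>.\<close>

inductive_set poly_funs :: "nat \<Rightarrow> ((nat \<Rightarrow> 'k::comm_ring_1) \<Rightarrow> 'k) set" for n :: nat where
  const: "(\<lambda>_. c) \<in> poly_funs n"
| coord: "i < n \<Longrightarrow> (\<lambda>x. x i) \<in> poly_funs n"
| add: "\<lbrakk>p \<in> poly_funs n; q \<in> poly_funs n\<rbrakk> \<Longrightarrow> (\<lambda>x. p x + q x) \<in> poly_funs n"
| mult: "\<lbrakk>p \<in> poly_funs n; q \<in> poly_funs n\<rbrakk> \<Longrightarrow> (\<lambda>x. p x * q x) \<in> poly_funs n"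

definition zero_set :: "nat \<Rightarrow> ((nat \<Rightarrow> 'k::field) \<Rightarrow> 'k) set \<Rightarrow> (nat \<Rightarrow> 'k) set" where
  "zero_set n S = {x \<in> affine_points n. \<forall>p\<in>S. p x = 0}"

definition zariski :: "nat \<Rightarrow> (nat \<Rightarrow> 'k::field) topology" where
  "zariski n = topology (\<lambda>U. \<exists>S \<subseteq> poly_funs n. U = affine_points n - zero_set n S)"

lemma diff_zero_set: "affine_points n - zero_set n S = {x \<in> affine_points n. \<exists>p\<in>S. p x \<noteq> 0}"
  by (auto simp: zero_set_def)

lemma istopology_zariski:
  "istopology (\<lambda>U. \<exists>S \<subseteq> poly_funs n. U = affine_points n - zero_set n (S :: ((nat \<Rightarrow> 'k::field) \<Rightarrow> 'k) set))"
  unfolding istopology_def diff_zero_set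
proof (intro conjI allI impI; (elim exE conjE)?)
  fix U V :: "(nat \<Rightarrow> 'k) set" and S T
  assume S: "S \<subseteq> poly_funs n" "U = {x \<in> affine_points n. \<exists>p\<in>S. p x \<noteq> 0}"
    and T: "T \<subseteq> poly_funs n" "V = {x \<in> affine_points n. \<exists>p\<in>T. p x \<noteq> 0}"
  let ?R = "(\<lambda>(p, q) x. p x * q x) ` (S \<times> T)"
  have "?R \<subseteq> poly_funs n"
    using S(1) T(1) by (auto intro!: poly_funs.mult)
  moreover have "U \<inter> V = {x \<in> affine_points n. \<exists>p\<in>?R. p x \<noteq> 0}"
    by (simp add: S(2) T(2) Bex_def) blast
  ultimately show "\<exists>S \<subseteq> poly_funs n. U \<inter> V = {x \<in> affine_points n. \<exists>p\<in>S. p x \<noteq> 0}"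
    by (intro exI[of _ ?R] conjI)
next
  fix \<K> :: "(nat \<Rightarrow> 'k) set set"
  assume *: "\<forall>K\<in>\<K>. \<exists>S \<subseteq> poly_funs n. K = {x \<in> affine_points n. \<exists>p\<in>S. p x \<noteq> 0}"
  obtain S where S: "\<forall>K\<in>\<K>. S K \<subseteq> poly_funs n \<and> K = {x \<in> affine_points n. \<exists>p\<in>S K. p x \<noteq> 0}"
    using bchoice[OF *] by (elim exE)
  have S1: "S K \<subseteq> poly_funs n" and S2: "x \<in> K \<longleftrightarrow> x \<in> affine_points n \<and> (\<exists>p\<in>S K. p x \<noteq> 0)"
    if "K \<in> \<K>" for x K
    using bspec[OF S that] by blast+
  let ?R = "\<Union>K\<in>\<K>. S K"
  have "x \<in> \<Union>\<K> \<longleftrightarrow> x \<in> affine_points n \<and> (\<exists>p\<in>?R. p x \<noteq> 0)" for x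
  proof -
    have "x \<in> \<Union>\<K> \<longleftrightarrow> (\<exists>K\<in>\<K>. x \<in> affine_points n \<and> (\<exists>p\<in>S K. p x \<noteq> 0))"
      unfolding Union_iff by (rule bex_cong[OF refl S2])
    then show ?thesis by auto
  qed
  then have "\<Union>\<K> = {x \<in> affine_points n. \<exists>p\<in>?R. p x \<noteq> 0}"
    by (intro set_eqI) (simp only: mem_Collect_eq)
  moreover have "?R \<subseteq> poly_funs n"
    using S1 by (rule UN_least)
  ultimately show "\<exists>S \<subseteq> poly_funs n. \<Union>\<K> = {x \<in> affine_points n. \<exists>p\<in>S. p x \<noteq> 0}"
    by (intro exI[of _ ?R] conjI)
qed

lemma openin_zariski:
  "openin (zariski n) U \<longleftrightarrow> (\<exists>S \<subseteq> poly_funs n. U = affine_points n - zero_set n S)"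
  unfolding zariski_def topology_inverse'[OF istopology_zariski] ..

lemma topspace_zariski: "topspace (zariski n) = affine_points n"
proof -
  have "openin (zariski n) (affine_points n :: (nat \<Rightarrow> 'a) set)"
    unfolding openin_zariski
    by (rule exI[of _ "{\<lambda>_. 1}"]) (auto simp: zero_set_def intro: poly_funs.const)
  then have "affine_points n \<subseteq> topspace (zariski n :: (nat \<Rightarrow> 'a) topology)"
    by (rule openin_subset)
  moreover have "topspace (zariski n :: (nat \<Rightarrow> 'a) topology) \<subseteq> affine_points n"
    using openin_topspace[of "zariski n :: (nat \<Rightarrow> 'a) topology"] unfolding openin_zariski by blast
  ultimately show ?thesis by blast
qed

lemma closedin_zariski:
  "closedin (zariski n) Z \<longleftrightarrow> (\<exists>S \<subseteq> poly_funs n. Z = zero_set n S)"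
proof -
  have sub: "zero_set n S \<subseteq> affine_points n" for S :: "((nat \<Rightarrow> 'a) \<Rightarrow> 'a) set"
    by (auto simp: zero_set_def)
  show ?thesis
  proof
    assume "closedin (zariski n) Z"
    then have Z: "Z \<subseteq> affine_points n"
      and "\<exists>S \<subseteq> poly_funs n. affine_points n - Z = affine_points n - zero_set n S"
      by (simp_all add: closedin_def topspace_zariski openin_zariski)
    then obtain S where "S \<subseteq> poly_funs n" "affine_points n - Z = affine_points n - zero_set n S"
      by blast
    moreover from this(2) Z sub[of S] have "Z = zero_set n S" by blast
    ultimately show "\<exists>S \<subseteq> poly_funs n. Z = zero_set n S" by blast
  next
    assume "\<exists>S \<subseteq> poly_funs n. Z = zero_set n S"
    then show "closedin (zariski n) Z"
      using sub by (auto simp: closedin_def topspace_zariski openin_zariski)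
  qed
qed

text \<open>
  A closed subset of affine space as a space with functions: the regular functions are those that
  are locally quotients of polynomials.
\<close>

definition affine_set :: "nat \<Rightarrow> (nat \<Rightarrow> 'k::field) set \<Rightarrow> (nat \<Rightarrow> 'k, 'k) fun_space" where
  "affine_set n Z =
     \<lparr>top_of = subtopology (zariski n) Z,
      regular = (\<lambda>U f. \<forall>x\<in>U. \<exists>V p q.
         openin (subtopology (zariski n) Z) V \<and> x \<in> V \<and> V \<subseteq> U \<and>
         p \<in> poly_funs n \<and> q \<in> poly_funs n \<and> (\<forall>y\<in>V. q y \<noteq> 0 \<and> f y = p y / q y))\<rparr>"

definition affine_space :: "nat \<Rightarrow> (nat \<Rightarrow> 'k::field, 'k) fun_space" where
  "affine_space n = affine_set n (affine_points n)"


section \<open>Varieties\<close>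

text \<open>Varieties are not required to be irreducible.\<close>

definition affine_variety :: "('a, 'k::field) fun_space \<Rightarrow> bool" where
  "affine_variety X \<longleftrightarrow>
     space_with_functions X \<and>
     (\<exists>n Z. closedin (zariski n) Z \<and> fun_isomorphic X (affine_set n Z))"

definition prevariety :: "('a, 'k::field) fun_space \<Rightarrow> bool" where
  "prevariety X \<longleftrightarrow>
     space_with_functions X \<and>
     (\<exists>\<U>. finite \<U> \<and> \<Union>\<U> = points X \<and>
        (\<forall>U\<in>\<U>. openin (top_of X) U \<and> affine_variety (open_subspace X U)))"

text \<open>
  Separatedness in the form: any two morphisms from an affine variety agree on a closed subset.
  Closed subsets of affine spaces are enough as test objects, since every affine variety is
  isomorphic to one.
\<close>

definition separated :: "('a, 'k::field) fun_space \<Rightarrow> bool" where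
  "separated X \<longleftrightarrow>
     (\<forall>n Z \<phi> \<psi>. closedin (zariski n) Z \<and>
        fun_morphism (affine_set n Z) X \<phi> \<and> fun_morphism (affine_set n Z) X \<psi> \<longrightarrow>
        closedin (zariski n) {z \<in> Z. \<phi> z = \<psi> z})"

definition variety :: "('a, 'k::field) fun_space \<Rightarrow> bool" where
  "variety X \<longleftrightarrow> prevariety X \<and> separated X"


section \<open>Dimension\<close>

definition irreducible_closed :: "'a topology \<Rightarrow> 'a set \<Rightarrow> bool" where
  "irreducible_closed T Z \<longleftrightarrow>
     closedin T Z \<and> Z \<noteq> {} \<and>
     (\<forall>A B. closedin T A \<and> closedin T B \<and> Z = A \<union> B \<longrightarrow> Z = A \<or> Z = B)"

definition irreducible_chain :: "'a topology \<Rightarrow> nat \<Rightarrow> (nat \<Rightarrow> 'a set) \<Rightarrow> bool" where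
  "irreducible_chain T m C \<longleftrightarrow>
     (\<forall>i\<le>m. irreducible_closed T (C i)) \<and> (\<forall>i<m. C i \<subset> C (Suc i))"

text \<open>
  The Krull dimension as a predicate: \<open>n\<close> is the maximal length of a chain.  In particular
  the empty space does not have any dimension.
\<close>

definition has_dimension :: "'a topology \<Rightarrow> nat \<Rightarrow> bool" where
  "has_dimension T n \<longleftrightarrow>
     (\<exists>C. irreducible_chain T n C) \<and> (\<forall>m C. irreducible_chain T m C \<longrightarrow> m \<le> n)"

end

theory Submission
  imports Defs
begin

text \<open>
  It is enough to find a surjective morphism from \<open>X\<close> onto affine \<open>n\<close>-space and to compose it with \<open>f\<close>.
  Such a morphism is provided by Noether normalization: \<open>X\<close> is isomorphic to a closed subset \<open>Z\<close> of some
  affine \<open>N\<close>-space, and a succession of linear projections maps \<open>Z\<close> finitely onto some affine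
  \<open>d\<close>-space.  It remains to see that \<open>d \<ge> n\<close>, since then \<open>n\<close> of the coordinates can be kept.

  One projection step goes as follows.  If a nonzero polynomial \<open>p\<close> vanishes on \<open>Z\<close>, its top form is
  nonzero in some direction, along which \<open>p\<close> is monic (\<open>exists_monic_direction\<close>).  The
  projection in this direction is integral on \<open>Z\<close>, so its image is closed (\<open>closed_projection\<close>).
  When no nonzero polynomial is left, the closed set is all of affine space.

  Dimension is controlled by the Hilbert function, which counts the linearly independent
  restrictions of polynomials of degree at most \<open>m\<close> to \<open>Z\<close>.  A chain of \<open>n + 1\<close> irreducible closed sets
  yields \<open>n\<close> polynomials which are algebraically independent on \<open>Z\<close>: at each inclusion take one that
  vanishes on the smaller set and not on the larger (\<open>alg_independent_on_irreducible_chain\<close>).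
  Their monomials make the Hilbert function grow at least like \<open>m\<^sup>n\<close>.  An integral projection
  divides it by at most a constant and rescales \<open>m\<close> (\<open>has_growth_project_along\<close>), whereas
  on affine \<open>d\<close>-space it grows like \<open>m\<^sup>d\<close>; hence \<open>n \<le> d\<close>.
\<close>

section \<open>Polynomial functions\<close>

lemma poly_funs_sum:
  assumes "\<And>i. i \<in> I \<Longrightarrow> p i \<in> poly_funs n"
  shows "(\<lambda>x. \<Sum>i\<in>I. p i x) \<in> poly_funs n"
  using assms
  by (induction I rule: infinite_finite_induct) (auto intro: poly_funs.intros)

lemma poly_funs_prod:
  assumes "\<And>i. i \<in> I \<Longrightarrow> p i \<in> poly_funs n"
  shows "(\<lambda>x. \<Prod>i\<in>I. p i x) \<in> poly_funs n"
  using assms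
  by (induction I rule: infinite_finite_induct) (auto intro: poly_funs.intros)

lemma poly_funs_power:
  assumes "p \<in> poly_funs n"
  shows "(\<lambda>x. p x ^ k) \<in> poly_funs n"
  using poly_funs_prod[of "{..<k}" "\<lambda>_. p"] assms by simp

lemma poly_funs_diff:
  assumes "p \<in> poly_funs n" "q \<in> poly_funs n"
  shows "(\<lambda>x. p x - q x) \<in> poly_funs n"
  using poly_funs.add[OF assms(1) poly_funs.mult[OF poly_funs.const[of "-1"] assms(2)]] by simp

lemma poly_funs_cong:
  assumes "p \<in> poly_funs n" "\<And>i. i < n \<Longrightarrow> x i = y i"
  shows "p x = p y"
  using assms by (induction rule: poly_funs.induct) auto

lemma poly_funs_compose:
  assumes "p \<in> poly_funs n" "\<And>i. i < n \<Longrightarrow> (\<lambda>x. g x i) \<in> poly_funs m"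
  shows "(\<lambda>x. p (g x)) \<in> poly_funs m"
  using assms by (induction rule: poly_funs.induct) (auto intro: poly_funs.intros)

text \<open>
  A curve whose coordinates are polynomials in \<open>t\<close> carries questions about polynomial functions over
  to one-variable polynomials, where roots and division are available.
\<close>

lemma poly_funs_on_curve:
  assumes "p \<in> poly_funs n"
  shows "\<exists>P. \<forall>t. p (\<lambda>i. poly (Q i) t) = poly P t"
  using assms
proof (induction rule: poly_funs.induct)
  case (const c)
  have "\<forall>t. c = poly [:c:] t" by simp
  then show ?case ..
next
  case (coord i)
  show ?case by blast
next
  case (add p q)
  then show ?case by (metis poly_add)
next
  case (mult p q)
  then show ?case by (metis poly_mult)
qed

text \<open>
  Total degree at most \<open>d\<close>.  Polynomials occur only as functions, so the degree is a filtration built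
  up one coordinate factor at a time rather than a number read off from coefficients.
\<close>

inductive poly_deg_le :: "nat \<Rightarrow> nat \<Rightarrow> ((nat \<Rightarrow> 'k::comm_ring_1) \<Rightarrow> 'k) \<Rightarrow> bool" for n where
  const: "poly_deg_le n d (\<lambda>_. c)"
| coord_mult: "\<lbrakk>i < n; poly_deg_le n d p\<rbrakk> \<Longrightarrow> poly_deg_le n (Suc d) (\<lambda>x. x i * p x)"
| add: "\<lbrakk>poly_deg_le n d p; poly_deg_le n d q\<rbrakk> \<Longrightarrow> poly_deg_le n d (\<lambda>x. p x + q x)"

lemma poly_deg_le_imp_poly_funs: "poly_deg_le n d p \<Longrightarrow> p \<in> poly_funs n"
  by (induction rule: poly_deg_le.induct) (auto intro: poly_funs.intros)

lemma poly_deg_le_mono: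
  assumes "poly_deg_le n d p" "d \<le> e"
  shows "poly_deg_le n e p"
  using assms
proof (induction arbitrary: e rule: poly_deg_le.induct)
  case (coord_mult i d p)
  then show ?case by (cases e) (auto intro: poly_deg_le.intros)
qed (auto intro: poly_deg_le.intros)

lemma poly_deg_le_smult:
  assumes "poly_deg_le n d p"
  shows "poly_deg_le n d (\<lambda>x. c * p x)"
  using assms
proof (induction rule: poly_deg_le.induct)
  case (coord_mult i d p)
  then show ?case
    using poly_deg_le.coord_mult[of i n d "\<lambda>x. c * p x"] by (simp add: mult.left_commute)
qed (auto simp: distrib_left intro: poly_deg_le.intros)

lemma poly_deg_le_mult:
  assumes "poly_deg_le n d p" "poly_deg_le n e q"
  shows "poly_deg_le n (d + e) (\<lambda>x. p x * q x)"
  using assms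
proof (induction rule: poly_deg_le.induct)
  case (const d c)
  then show ?case by (intro poly_deg_le_smult poly_deg_le_mono[OF const]) simp
next
  case (coord_mult i d p)
  then show ?case
    using poly_deg_le.coord_mult[of i n "d + e" "\<lambda>x. p x * q x"] by (simp add: mult.assoc)
qed (auto simp: distrib_right intro: poly_deg_le.intros)

lemma poly_deg_le_sum:
  assumes "\<And>i. i \<in> I \<Longrightarrow> poly_deg_le n d (p i)"
  shows "poly_deg_le n d (\<lambda>x. \<Sum>i\<in>I. p i x)"
  using assms
  by (induction I rule: infinite_finite_induct) (auto intro: poly_deg_le.intros)

lemma poly_deg_le_prod:
  assumes "\<And>i. i \<in> I \<Longrightarrow> poly_deg_le n (d i) (p i)"
  shows "poly_deg_le n (\<Sum>i\<in>I. d i) (\<lambda>x. \<Prod>i\<in>I. p i x)"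
  using assms
  by (induction I rule: infinite_finite_induct) (auto intro: poly_deg_le.const poly_deg_le_mult)

lemma poly_deg_le_power:
  assumes "poly_deg_le n d p"
  shows "poly_deg_le n (k * d) (\<lambda>x. p x ^ k)"
  using poly_deg_le_prod[of "{..<k}" n "\<lambda>_. d" "\<lambda>_. p"] assms by simp

lemma poly_funs_imp_poly_deg_le:
  assumes "p \<in> poly_funs n"
  shows "\<exists>d. poly_deg_le n d p"
  using assms
proof (induction rule: poly_funs.induct)
  case (const c)
  then show ?case by (blast intro: poly_deg_le.const)
next
  case (coord i)
  then show ?case
    using poly_deg_le.coord_mult[OF _ poly_deg_le.const[of n 0 1]] by auto
next
  case (add p q)
  then obtain d e where "poly_deg_le n d p" "poly_deg_le n e q" by blast
  then have "poly_deg_le n (d + e) p" "poly_deg_le n (d + e) q"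
    by (simp_all add: poly_deg_le_mono)
  then show ?case by (blast intro: poly_deg_le.add)
next
  case (mult p q)
  then show ?case by (blast intro: poly_deg_le_mult)
qed

lemma finite_family_poly_deg_le:
  assumes "finite I" "\<And>i. i \<in> I \<Longrightarrow> p i \<in> poly_funs n"
  obtains d where "\<And>i. i \<in> I \<Longrightarrow> poly_deg_le n d (p i)"
proof -
  have "\<forall>i\<in>I. \<exists>d. poly_deg_le n d (p i)"
    using assms(2) poly_funs_imp_poly_deg_le by blast
  then obtain d where d: "\<forall>i\<in>I. poly_deg_le n (d i) (p i)" by metis
  have "poly_deg_le n (\<Sum>i\<in>I. d i) (p i)" if "i \<in> I" for i
    using d that assms(1) by (meson poly_deg_le_mono member_le_sum zero_le)
  then show ?thesis using that by blast
qed


section \<open>Projections along a line\<close>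

text \<open>
  For \<open>v\<^sub>N = 1\<close> this is the projection of affine \<open>(N + 1)\<close>-space onto the hyperplane \<open>x\<^sub>N = 0\<close> in the
  direction \<open>v\<close>: its fibres are the lines parallel to \<open>v\<close>, each of them parametrised by \<open>x\<^sub>N\<close>.
  Projecting obliquely takes the place of a linear change of coordinates.
\<close>

definition project_along :: "(nat \<Rightarrow> 'k::comm_ring_1) \<Rightarrow> nat \<Rightarrow> (nat \<Rightarrow> 'k) \<Rightarrow> (nat \<Rightarrow> 'k)" where
  "project_along v N x = (\<lambda>i\<in>{..<N}. x i - v i * x N)"

lemma project_along_in_affine_points: "project_along v N x \<in> affine_points N"
  by (auto simp: project_along_def affine_points_def)

lemma poly_funs_project_along:
  assumes "p \<in> poly_funs N"
  shows "(\<lambda>x. p (project_along v N x)) \<in> poly_funs (Suc N)"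
proof (rule poly_funs_compose[OF assms])
  fix i assume "i < N"
  then show "(\<lambda>x. project_along v N x i) \<in> poly_funs (Suc N)"
    unfolding project_along_def
    by (auto intro!: poly_funs_diff poly_funs.mult poly_funs.coord intro: poly_funs.const)
qed

text \<open>
  The polynomial ring in \<open>N + 1\<close> variables is the ring of polynomials in \<open>x\<^sub>N\<close> whose coefficients are
  polynomials in the coordinates of the projection along \<open>v\<close>.  Substituting \<open>y + t v\<close> into \<open>f\<close>, only
  the homogeneous part \<open>h\<close> of degree \<open>d\<close> contributes to \<open>t\<^sup>d\<close>, and it contributes \<open>h v\<close>; therefore the
  leading coefficient is a constant.  All conclusions concern one and the same \<open>h\<close>, so a single
  induction proves them together.
\<close>

lemma top_form_exists:
  fixes f :: "(nat \<Rightarrow> 'k::comm_ring_1) \<Rightarrow> 'k"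
  assumes "poly_deg_le (Suc N) d f"
  shows "\<exists>h q. h \<in> poly_funs (Suc N) \<and> (\<forall>x. f x = h x + q x) \<and>
           (if d = 0 then q = (\<lambda>_. 0) else poly_deg_le (Suc N) (d - 1) q) \<and>
           (\<forall>s x. h (\<lambda>i. s * x i) = s ^ d * h x) \<and>
           (\<forall>v. v N = 1 \<longrightarrow> (\<exists>c. (\<forall>i. poly_deg_le N d (c i)) \<and> c d = (\<lambda>_. h v) \<and>
              (\<forall>x. f x = (\<Sum>i\<le>d. c i (project_along v N x) * x N ^ i))))"
  using assms
proof (induction rule: poly_deg_le.induct)
  case (const d a)
  define h :: "(nat \<Rightarrow> 'k) \<Rightarrow> 'k" where "h = (\<lambda>_. if d = 0 then a else 0)"
  define q :: "(nat \<Rightarrow> 'k) \<Rightarrow> 'k" where "q = (\<lambda>_. if d = 0 then 0 else a)"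
  have "\<exists>c. (\<forall>i. poly_deg_le N d (c i)) \<and> c d = (\<lambda>_. h v) \<and>
          (\<forall>x. a = (\<Sum>i\<le>d. c i (project_along v N x) * x N ^ i))" for v
  proof (intro exI[of _ "\<lambda>i _. if i = 0 then a else 0"] conjI allI)
    fix x :: "nat \<Rightarrow> 'k"
    have "(\<Sum>i\<le>d. (if i = 0 then a else 0) * x N ^ i) = (\<Sum>i\<le>d. if i = 0 then a else 0)"
      by (rule sum.cong) auto
    then show "a = (\<Sum>i\<le>d. (if i = 0 then a else 0) * x N ^ i)" by simp
  qed (auto simp: h_def intro: poly_deg_le.const)
  moreover have "h \<in> poly_funs (Suc N)" "\<forall>x. a = h x + q x"
      "if d = 0 then q = (\<lambda>_. 0) else poly_deg_le (Suc N) (d - 1) q"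
      "\<forall>s x. h (\<lambda>i. s * x i) = s ^ d * h x"
    by (auto simp: h_def q_def intro: poly_funs.const poly_deg_le.const)
  ultimately show ?case by blast
next
  case (coord_mult j d f)
  then obtain h q where h: "h \<in> poly_funs (Suc N)" and f: "\<forall>x. f x = h x + q x"
    and q: "if d = 0 then q = (\<lambda>_. 0) else poly_deg_le (Suc N) (d - 1) q"
    and hom: "\<forall>s x. h (\<lambda>i. s * x i) = s ^ d * h x"
    and exp: "\<And>v. v N = 1 \<Longrightarrow> \<exists>c. (\<forall>i. poly_deg_le N d (c i)) \<and> c d = (\<lambda>_. h v) \<and>
              (\<forall>x. f x = (\<Sum>i\<le>d. c i (project_along v N x) * x N ^ i))"
    by blast
  have "(\<lambda>x. x j * h x) \<in> poly_funs (Suc N)"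
    using h coord_mult.hyps by (auto intro: poly_funs.intros)
  moreover have "\<forall>x. x j * f x = x j * h x + x j * q x"
    using f by (simp add: distrib_left)
  moreover have "poly_deg_le (Suc N) d (\<lambda>x. x j * q x)"
  proof (cases d)
    case 0
    then show ?thesis using q by (auto intro: poly_deg_le.const)
  next
    case (Suc d')
    then show ?thesis using q coord_mult.hyps by (auto intro: poly_deg_le.coord_mult)
  qed
  moreover have "\<forall>s x. (s * x j) * h (\<lambda>i. s * x i) = s ^ Suc d * (x j * h x)"
    using hom by (simp add: mult_ac)
  moreover have "\<exists>c. (\<forall>i. poly_deg_le N (Suc d) (c i)) \<and> c (Suc d) = (\<lambda>_. v j * h v) \<and>
          (\<forall>x. x j * f x = (\<Sum>i\<le>Suc d. c i (project_along v N x) * x N ^ i))" if v: "v N = 1" for v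
  proof -
    from exp[of v, OF v] obtain c where c: "\<forall>i. poly_deg_le N d (c i)" "c d = (\<lambda>_. h v)"
      "\<forall>x. f x = (\<Sum>i\<le>d. c i (project_along v N x) * x N ^ i)" by blast
    define y :: "(nat \<Rightarrow> 'k) \<Rightarrow> 'k" where "y = (\<lambda>x. if j < N then x j else 0)"
    \<comment> \<open>Write \<open>x\<^sub>j\<close> as the \<open>j\<close>-th coordinate of the projection plus \<open>v\<^sub>j x\<^sub>N\<close>; for \<open>j = N\<close> the first
      summand is absent.\<close>
    have y: "x j = y (project_along v N x) + v j * x N" for x
      using coord_mult.hyps v by (auto simp: y_def project_along_def less_Suc_eq)
    define c' where "c' = (\<lambda>i x. (if i \<le> d then y x * c i x else 0) +
        (if i = 0 then 0 else v j * c (i - 1) x))"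
    have yc: "poly_deg_le N (Suc d) (\<lambda>x. y x * c i x)" for i
      using c(1) by (cases "j < N") (auto simp: y_def intro: poly_deg_le.intros)
    have vc: "poly_deg_le N (Suc d) (\<lambda>x. v j * c i x)" for i
      by (rule poly_deg_le_smult[OF poly_deg_le_mono[OF spec[OF c(1)]]]) simp
    have "poly_deg_le N (Suc d) (c' i)" for i
      unfolding c'_def
      using yc vc by (cases "i \<le> d"; cases "i = 0") (auto intro: poly_deg_le.intros)
    moreover have "c' (Suc d) = (\<lambda>_. v j * h v)"
      using c(2) by (simp add: c'_def)
    moreover have "x j * f x = (\<Sum>i\<le>Suc d. c' i (project_along v N x) * x N ^ i)" for x
    proof -
      let ?\<pi> = "project_along v N x"
      have "(\<Sum>i\<le>Suc d. c' i ?\<pi> * x N ^ i) =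
          (\<Sum>i\<le>Suc d. (if i \<le> d then y ?\<pi> * c i ?\<pi> else 0) * x N ^ i) +
          (\<Sum>i\<le>Suc d. (if i = 0 then 0 else v j * c (i - 1) ?\<pi>) * x N ^ i)"
        by (simp only: c'_def distrib_right sum.distrib)
      also have "(\<Sum>i\<le>Suc d. (if i \<le> d then y ?\<pi> * c i ?\<pi> else 0) * x N ^ i) =
          (\<Sum>i\<le>d. y ?\<pi> * c i ?\<pi> * x N ^ i)"
        by simp
      also have "\<dots> = y ?\<pi> * f x"
        using c(3) by (simp add: sum_distrib_left mult.assoc)
      also have "(\<Sum>i\<le>Suc d. (if i = 0 then 0 else v j * c (i - 1) ?\<pi>) * x N ^ i) =
          (\<Sum>i\<le>d. v j * c i ?\<pi> * x N ^ Suc i)"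
        by (subst sum.atMost_Suc_shift) simp
      also have "\<dots> = v j * x N * f x"
        using c(3) by (simp add: sum_distrib_left mult_ac)
      finally show ?thesis using y[of x] by (simp add: distrib_right)
    qed
    ultimately show ?thesis by blast
  qed
  ultimately show ?case
    by (intro exI[of _ "\<lambda>x. x j * h x"] exI[of _ "\<lambda>x. x j * q x"]) simp
next
  case (add d f1 f2)
  from add.IH(1) obtain h1 q1 where
    1: "h1 \<in> poly_funs (Suc N)" "\<forall>x. f1 x = h1 x + q1 x"
      "if d = 0 then q1 = (\<lambda>_. 0) else poly_deg_le (Suc N) (d - 1) q1"
      "\<forall>s x. h1 (\<lambda>i. s * x i) = s ^ d * h1 x"
      "\<forall>v. v N = 1 \<longrightarrow> (\<exists>c. (\<forall>i. poly_deg_le N d (c i)) \<and> c d = (\<lambda>_. h1 v) \<and>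
         (\<forall>x. f1 x = (\<Sum>i\<le>d. c i (project_along v N x) * x N ^ i)))"
    by blast
  from add.IH(2) obtain h2 q2 where
    2: "h2 \<in> poly_funs (Suc N)" "\<forall>x. f2 x = h2 x + q2 x"
      "if d = 0 then q2 = (\<lambda>_. 0) else poly_deg_le (Suc N) (d - 1) q2"
      "\<forall>s x. h2 (\<lambda>i. s * x i) = s ^ d * h2 x"
      "\<forall>v. v N = 1 \<longrightarrow> (\<exists>c. (\<forall>i. poly_deg_le N d (c i)) \<and> c d = (\<lambda>_. h2 v) \<and>
         (\<forall>x. f2 x = (\<Sum>i\<le>d. c i (project_along v N x) * x N ^ i)))"
    by blast
  have "\<exists>c. (\<forall>i. poly_deg_le N d (c i)) \<and> c d = (\<lambda>_. h1 v + h2 v) \<and>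
          (\<forall>x. f1 x + f2 x = (\<Sum>i\<le>d. c i (project_along v N x) * x N ^ i))" if v: "v N = 1" for v
  proof -
    from 1(5) v obtain c1 where c1: "\<forall>i. poly_deg_le N d (c1 i)" "c1 d = (\<lambda>_. h1 v)"
        "\<forall>x. f1 x = (\<Sum>i\<le>d. c1 i (project_along v N x) * x N ^ i)"
      by blast
    from 2(5) v obtain c2 where c2: "\<forall>i. poly_deg_le N d (c2 i)" "c2 d = (\<lambda>_. h2 v)"
        "\<forall>x. f2 x = (\<Sum>i\<le>d. c2 i (project_along v N x) * x N ^ i)"
      by blast
    show ?thesis
      by (intro exI[of _ "\<lambda>i x. c1 i x + c2 i x"])
        (simp add: c1 c2 poly_deg_le.add distrib_right sum.distrib)
  qed
  moreover have "(\<lambda>x. h1 x + h2 x) \<in> poly_funs (Suc N)"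
    by (rule poly_funs.add[OF 1(1) 2(1)])
  moreover have "\<forall>x. f1 x + f2 x = (h1 x + h2 x) + (q1 x + q2 x)"
    using 1(2) 2(2) by simp
  moreover have "if d = 0 then (\<lambda>x. q1 x + q2 x) = (\<lambda>_. 0)
      else poly_deg_le (Suc N) (d - 1) (\<lambda>x. q1 x + q2 x)"
    using 1(3) 2(3) poly_deg_le.add[of "Suc N" "d - 1" q1 q2] by (simp split: if_splits)
  moreover have "\<forall>s x. h1 (\<lambda>i. s * x i) + h2 (\<lambda>i. s * x i) = s ^ d * (h1 x + h2 x)"
    using 1(4) 2(4) by (simp add: distrib_left)
  ultimately show ?case
    by (intro exI[of _ "\<lambda>x. h1 x + h2 x"] exI[of _ "\<lambda>x. q1 x + q2 x"]) simp
qed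


text \<open>
  The top form \<open>h\<close> of a nonzero polynomial is nonzero, so some direction \<open>v\<close> off the hyperplane
  \<open>x\<^sub>N = 0\<close> has \<open>h v \<noteq> 0\<close>.  Along this direction \<open>p\<close> is, up to a constant, monic in \<open>x\<^sub>N\<close>.  The equation
  is multiplied by \<open>x\<^sub>N\<close> once more, which makes its degree positive even if \<open>p\<close> is constant.
\<close>

lemma exists_monic_direction:
  fixes p :: "(nat \<Rightarrow> 'k::field_char_0) \<Rightarrow> 'k"
  assumes "p \<in> poly_funs (Suc N)" "p x0 \<noteq> 0"
  obtains v e a where "v N = 1" "\<And>i. a i \<in> poly_funs N"
    "\<And>x. p x = 0 \<Longrightarrow> x N ^ Suc e = (\<Sum>i\<le>e. a i (project_along v N x) * x N ^ i)"
proof -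
  define d where "d = (LEAST d. poly_deg_le (Suc N) d p)"
  have d: "poly_deg_le (Suc N) d p"
    unfolding d_def by (rule LeastI_ex[OF poly_funs_imp_poly_deg_le[OF assms(1)]])
  obtain h q where h: "h \<in> poly_funs (Suc N)" and pq: "\<forall>x. p x = h x + q x"
    and q: "if d = 0 then q = (\<lambda>_. 0) else poly_deg_le (Suc N) (d - 1) q"
    and hom: "\<forall>s x. h (\<lambda>i. s * x i) = s ^ d * h x"
    and exp: "\<forall>v. v N = 1 \<longrightarrow> (\<exists>c. (\<forall>i. poly_deg_le N d (c i)) \<and> c d = (\<lambda>_. h v) \<and>
              (\<forall>x. p x = (\<Sum>i\<le>d. c i (project_along v N x) * x N ^ i)))"
    using top_form_exists[OF d] by blast
  have "\<exists>u. h u \<noteq> 0"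
  proof (rule ccontr)
    assume "\<not> (\<exists>u. h u \<noteq> 0)"
    then have "p = q" using pq by auto
    show False
    proof (cases "d = 0")
      case True
      then show False using \<open>p = q\<close> q assms(2) by simp
    next
      case False
      then have "poly_deg_le (Suc N) (d - 1) p" using q \<open>p = q\<close> by simp
      then have "d \<le> d - 1" unfolding d_def by (rule Least_le)
      then show False using False by simp
    qed
  qed
  then obtain u where u: "h u \<noteq> 0" by blast
  \<comment> \<open>Move \<open>u\<close> off the hyperplane \<open>x\<^sub>N = 0\<close>; then homogeneity allows scaling to \<open>x\<^sub>N = 1\<close>.\<close>
  obtain P where "\<forall>t. h (\<lambda>i. poly (if i = N then [:0, 1:] else [:u i:]) t) = poly P t"
    using poly_funs_on_curve[OF h, of "\<lambda>i. if i = N then [:0, 1:] else [:u i:]"] by blast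
  moreover have "(\<lambda>i. poly (if i = N then [:0, 1:] else [:u i:]) t) = u(N := t)" for t
    by auto
  ultimately have P: "h (u(N := t)) = poly P t" for t by metis
  from u P[of "u N"] have "P \<noteq> 0" by auto
  then have "finite {t. t = 0 \<or> poly P t = 0}"
    using poly_roots_finite[of P] by (simp add: Collect_disj_eq)
  then obtain t where t: "t \<noteq> 0" "poly P t \<noteq> 0"
    using infinite_UNIV_char_0[where ?'a = 'k] by (metis (mono_tags, lifting) UNIV_eq_I mem_Collect_eq)
  define v where "v = (\<lambda>i. inverse t * (u(N := t)) i)"
  have vN: "v N = 1" using t by (simp add: v_def)
  have "h v = inverse t ^ d * h (u(N := t))"
    unfolding v_def using hom by blast
  then have hv: "h v \<noteq> 0" using t P by simp
  from exp vN obtain c where c: "\<forall>i. poly_deg_le N d (c i)" "c d = (\<lambda>_. h v)"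
    "\<forall>x. p x = (\<Sum>i\<le>d. c i (project_along v N x) * x N ^ i)"
    by blast
  define a where "a = (\<lambda>i x. if i = 0 then 0 else - inverse (h v) * c (i - 1) x)"
  have "(\<lambda>x. - inverse (h v) * c i x) \<in> poly_funs N" for i
    by (rule poly_funs.mult[OF poly_funs.const poly_deg_le_imp_poly_funs]) (use c(1) in blast)
  then have "a i \<in> poly_funs N" for i
    unfolding a_def by (cases "i = 0") (simp_all add: poly_funs.const del: mult_minus_left)
  moreover have "x N ^ Suc d = (\<Sum>i\<le>d. a i (project_along v N x) * x N ^ i)" if "p x = 0" for x
  proof -
    let ?\<pi> = "project_along v N x"
    have "0 = (\<Sum>i\<le>d. c i ?\<pi> * x N ^ i)"
      using c(3) that by metis
    also have "\<dots> = h v * x N ^ d + (\<Sum>i<d. c i ?\<pi> * x N ^ i)"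
      using c(2) by (simp add: lessThan_Suc_atMost[symmetric])
    finally have *: "x N ^ d = - inverse (h v) * (\<Sum>i<d. c i ?\<pi> * x N ^ i)"
      using hv by (simp add: field_simps add_eq_0_iff)
    have "x N ^ Suc d = (\<Sum>i<d. - inverse (h v) * c i ?\<pi> * x N ^ Suc i)"
      using arg_cong[OF *, of "\<lambda>y. x N * y"] by (simp add: sum_distrib_left sum_negf mult_ac)
    also have "\<dots> = (\<Sum>i<Suc d. a i ?\<pi> * x N ^ i)"
      by (subst sum.lessThan_Suc_shift) (simp add: a_def)
    finally show ?thesis by (simp only: lessThan_Suc_atMost)
  qed
  ultimately show ?thesis using that vN by blast
qed

text \<open>
  The coefficients of the remainder of \<open>t\<^sup>m\<close> on division by \<open>t\<^sup>e\<^sup>+\<^sup>1 - (a\<^sub>0 + a\<^sub>1 t + \<dots> + a\<^sub>e t\<^sup>e)\<close>: multiplying a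
  remainder by \<open>t\<close> shifts its coefficients and replaces \<open>t\<^sup>e\<^sup>+\<^sup>1\<close>.
\<close>

primrec reduced_power ::
    "(nat \<Rightarrow> 'x \<Rightarrow> 'k::comm_ring_1) \<Rightarrow> nat \<Rightarrow> nat \<Rightarrow> nat \<Rightarrow> 'x \<Rightarrow> 'k" where
  "reduced_power a e 0 = (\<lambda>i y. if i = 0 then 1 else 0)"
| "reduced_power a e (Suc m) = (\<lambda>i y.
     (if i = 0 then 0 else reduced_power a e m (i - 1) y) + reduced_power a e m e y * a i y)"

lemma power_eq_reduced_power:
  assumes "t ^ Suc e = (\<Sum>i\<le>e. a i y * t ^ i)"
  shows "t ^ m = (\<Sum>i\<le>e. reduced_power a e m i y * t ^ i)"
proof (induction m)
  case 0
  have "(\<Sum>i\<le>e. reduced_power a e 0 i y * t ^ i) = (\<Sum>i\<le>e. if i = 0 then 1 else 0)"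
    by (rule sum.cong) auto
  then show ?case by simp
next
  case (Suc m)
  let ?r = "\<lambda>i. reduced_power a e m i y"
  have "(\<Sum>i\<le>e. reduced_power a e (Suc m) i y * t ^ i) =
      (\<Sum>i\<le>e. (if i = 0 then 0 else ?r (i - 1)) * t ^ i) + (\<Sum>i\<le>e. ?r e * a i y * t ^ i)"
    by (simp add: distrib_right sum.distrib)
  also have "(\<Sum>i\<le>e. (if i = 0 then 0 else ?r (i - 1)) * t ^ i) = (\<Sum>i<e. ?r i * t ^ Suc i)"
    unfolding lessThan_Suc_atMost[symmetric] by (subst sum.lessThan_Suc_shift) simp
  also have "(\<Sum>i\<le>e. ?r e * a i y * t ^ i) = ?r e * t ^ Suc e"
    using assms by (simp add: sum_distrib_left mult.assoc)
  also have "(\<Sum>i<e. ?r i * t ^ Suc i) + ?r e * t ^ Suc e = t * (\<Sum>i\<le>e. ?r i * t ^ i)"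
    by (simp add: lessThan_Suc_atMost[symmetric] sum_distrib_left distrib_left mult_ac)
  finally show ?case using Suc by simp
qed

lemma reduced_power_small:
  assumes "m \<le> e" "i \<le> e"
  shows "reduced_power a e m i y = (if i = m then 1 else 0)"
  using assms
proof (induction m arbitrary: i)
  case (Suc m)
  then show ?case by auto
qed simp

text \<open>
  Each further factor \<open>t\<close> raises the degree of the coefficients by at most a constant.  This linear
  bound is what makes the growth comparison along a projection work.
\<close>

lemma poly_deg_le_reduced_power:
  assumes "\<And>i. poly_deg_le N E (a i)"
  shows "poly_deg_le N (m * E) (reduced_power a e m i)"
proof (induction m arbitrary: i)
  case 0
  show ?case by (auto intro: poly_deg_le.const)
next
  case (Suc m)
  have "poly_deg_le N (Suc m * E) (\<lambda>y. if i = 0 then 0 else reduced_power a e m (i - 1) y)"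
    using poly_deg_le_mono[OF Suc, of "Suc m * E" "i - 1"]
    by (cases "i = 0") (auto intro: poly_deg_le.const)
  moreover have "poly_deg_le N (Suc m * E) (\<lambda>y. reduced_power a e m e y * a i y)"
    using poly_deg_le_mult[OF Suc assms] by (simp add: add.commute)
  ultimately show ?case by (auto intro: poly_deg_le.add)
qed

lemma poly_funs_reduced_power:
  assumes "\<And>i. a i \<in> poly_funs N"
  shows "reduced_power a e m i \<in> poly_funs N"
proof (induction m arbitrary: i)
  case (Suc m)
  then show ?case
    using assms by (cases "i = 0") (auto intro!: poly_funs.add poly_funs.mult poly_funs.const)
qed (auto intro: poly_funs.const)


section \<open>The image of an integral projection is closed\<close>

text \<open>
  A homogeneous linear system satisfied by the vector \<open>(1, t, \<dots>, t\<^sup>e)\<close> forces its determinant to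
  vanish, while the determinant is \<open>1\<close> at \<open>b\<close>.  Gaussian elimination without division, removing the
  highest power each time and keeping the matrix the identity at \<open>b\<close>, produces the required function
  directly.
\<close>

lemma eliminate_powers:
  fixes M :: "nat \<Rightarrow> nat \<Rightarrow> (nat \<Rightarrow> 'k::field) \<Rightarrow> 'k"
  assumes "\<And>j i. M j i \<in> poly_funs N"
    and "\<And>x j. x \<in> Z \<Longrightarrow> j \<le> e \<Longrightarrow> (\<Sum>i\<le>e. M j i (\<pi> x) * t x ^ i) = 0"
    and "\<And>j i. j \<le> e \<Longrightarrow> i \<le> e \<Longrightarrow> M j i b = (if i = j then 1 else 0)"
  shows "\<exists>r\<in>poly_funs N. r b \<noteq> 0 \<and> (\<forall>x\<in>Z. r (\<pi> x) = 0)"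
  using assms
proof (induction e arbitrary: M)
  case 0
  from "0.prems"(2)[of _ 0] "0.prems"(1)[of 0 0] "0.prems"(3)[of 0 0]
  show ?case by (intro bexI[of _ "M 0 0"]) auto
next
  case (Suc e)
  define D where "D = M (Suc e) (Suc e)"
  define M' where "M' = (\<lambda>j i y. D y * M j i y - M j (Suc e) y * M (Suc e) i y)"
  show ?case
  proof (rule Suc.IH)
    show "M' j i \<in> poly_funs N" for j i
      unfolding M'_def D_def using Suc.prems(1) by (intro poly_funs_diff poly_funs.mult)
    show "M' j i b = (if i = j then 1 else 0)" if "j \<le> e" "i \<le> e" for j i
      using that Suc.prems(3) by (auto simp: M'_def D_def)
    show "(\<Sum>i\<le>e. M' j i (\<pi> x) * t x ^ i) = 0" if x: "x \<in> Z" and j: "j \<le> e" for x j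
    proof -
      let ?y = "\<pi> x"
      have "(\<Sum>i\<le>e. M' j i ?y * t x ^ i) =
          D ?y * (\<Sum>i\<le>e. M j i ?y * t x ^ i) - M j (Suc e) ?y * (\<Sum>i\<le>e. M (Suc e) i ?y * t x ^ i)"
        by (simp add: M'_def left_diff_distrib sum_subtractf sum_distrib_left mult.assoc)
      also have "(\<Sum>i\<le>e. M j i ?y * t x ^ i) = - (M j (Suc e) ?y * t x ^ Suc e)"
        using Suc.prems(2)[OF x, of j] j by (simp add: eq_neg_iff_add_eq_0)
      also have "(\<Sum>i\<le>e. M (Suc e) i ?y * t x ^ i) = - (D ?y * t x ^ Suc e)"
        using Suc.prems(2)[OF x, of "Suc e"] by (simp add: eq_neg_iff_add_eq_0 D_def)
      finally show ?thesis by (simp add: algebra_simps)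
    qed
  qed
qed

lemma principal_ideal_of_polys:
  fixes J :: "'k::field poly set"
  assumes "0 \<in> J" "\<And>P Q. P \<in> J \<Longrightarrow> Q \<in> J \<Longrightarrow> P + Q \<in> J" "\<And>P Q. P \<in> J \<Longrightarrow> P * Q \<in> J"
  obtains g where "g \<in> J" "\<And>P. P \<in> J \<Longrightarrow> g dvd P"
proof (cases "J \<subseteq> {0}")
  case True
  then show ?thesis using that[of 0] assms(1) by blast
next
  case False
  then obtain P0 where "P0 \<in> J \<and> P0 \<noteq> 0" by blast
  from ex_has_least_nat[of "\<lambda>P. P \<in> J \<and> P \<noteq> 0", OF this, of degree]
  obtain g where g: "g \<in> J" "g \<noteq> 0" and min: "\<And>P. P \<in> J \<Longrightarrow> P \<noteq> 0 \<Longrightarrow> degree g \<le> degree P"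
    by blast
  have "g dvd P" if P: "P \<in> J" for P
  proof (rule ccontr)
    assume "\<not> g dvd P"
    then have "P mod g \<noteq> 0" by auto
    have "P mod g = P + g * (- (P div g))"
      by (simp add: minus_mult_div_eq_mod[symmetric])
    then have "P mod g \<in> J" using assms(2,3) P g(1) by metis
    then have "degree g \<le> degree (P mod g)" using min \<open>P mod g \<noteq> 0\<close> by blast
    then show False using degree_mod_less[OF g(2), of P] \<open>P mod g \<noteq> 0\<close> by simp
  qed
  then show ?thesis using that g(1) by blast
qed

text \<open>
  A point \<open>b\<close> outside the image has to be separated from it by a polynomial.  The line over \<open>b\<close> misses
  \<open>Z\<close>, so the restrictions to this line of the equations of \<open>Z\<close> generate the unit ideal of \<open>k[t]\<close>, as
  \<open>k\<close> is algebraically closed: some polynomial \<open>q\<close> vanishes on \<open>Z\<close> and equals \<open>1\<close> on the whole line.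
  Modulo the integral equation, multiplication by \<open>q\<close> is a matrix over the base which is the identity
  at \<open>b\<close>, and eliminating the powers of \<open>x\<^sub>N\<close> from the equations \<open>x\<^sub>N\<^sup>j q = 0\<close> gives the separating
  polynomial.
\<close>

lemma closed_projection:
  fixes Z :: "(nat \<Rightarrow> 'k::{alg_closed_field, field_char_0}) set"
  assumes Z: "closedin (zariski (Suc N)) Z" and v: "v N = 1" and a: "\<And>i. a i \<in> poly_funs N"
    and integral: "\<And>x. x \<in> Z \<Longrightarrow> x N ^ Suc e = (\<Sum>i\<le>e. a i (project_along v N x) * x N ^ i)"
  shows "closedin (zariski N) (project_along v N ` Z)"
proof -
  let ?\<pi> = "project_along v N"
  obtain S where S: "S \<subseteq> poly_funs (Suc N)" "Z = zero_set (Suc N) S"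
    using Z unfolding closedin_zariski by blast
  have separate: "\<exists>r\<in>poly_funs N. r b \<noteq> 0 \<and> (\<forall>x\<in>Z. r (?\<pi> x) = 0)"
    if b: "b \<in> affine_points N" "b \<notin> ?\<pi> ` Z" for b
  proof -
    \<comment> \<open>The fibre of the projection over \<open>b\<close>, parametrised by the last coordinate.\<close>
    define line where "line = (\<lambda>t. \<lambda>i\<in>{..<Suc N}. (if i < N then b i else 0) + v i * t)"
    have line_N: "line t N = t" for t using v by (simp add: line_def)
    have line_\<pi>: "?\<pi> (line t) = b" for t
      using b(1) v by (auto simp: project_along_def line_def affine_points_def fun_eq_iff PiE_def extensional_def)
    have line_in: "line t \<in> affine_points (Suc N)" for t
      by (auto simp: line_def affine_points_def)
    have line_notin: "line t \<notin> Z" for t using b(2) line_\<pi> by (metis imageI)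
    have on_line: "\<exists>P. \<forall>t. f (line t) = poly P t" if f: "f \<in> poly_funs (Suc N)" for f
    proof -
      have "f (line t) = f (\<lambda>i. poly [:if i < N then b i else 0, v i:] t)" for t
        by (rule poly_funs_cong[OF f]) (simp add: line_def mult.commute)
      then show ?thesis using poly_funs_on_curve[OF f] by metis
    qed
    define J where "J = {P. \<exists>f\<in>poly_funs (Suc N). (\<forall>x\<in>Z. f x = 0) \<and> (\<forall>t. f (line t) = poly P t)}"
    have "0 \<in> J"
      unfolding J_def by (auto intro!: bexI[of _ "\<lambda>_. 0"] poly_funs.const)
    moreover have "P + Q \<in> J" if PQ: "P \<in> J" "Q \<in> J" for P Q
    proof -
      from PQ obtain f g where "f \<in> poly_funs (Suc N)" "\<forall>x\<in>Z. f x = 0" "\<forall>t. f (line t) = poly P t"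
        "g \<in> poly_funs (Suc N)" "\<forall>x\<in>Z. g x = 0" "\<forall>t. g (line t) = poly Q t"
        unfolding J_def by blast
      then show ?thesis
        unfolding J_def by (auto intro!: bexI[of _ "\<lambda>x. f x + g x"] poly_funs.add)
    qed
    moreover have "P * Q \<in> J" if P: "P \<in> J" for P Q
    proof -
      from P obtain f where "f \<in> poly_funs (Suc N)" "\<forall>x\<in>Z. f x = 0" "\<forall>t. f (line t) = poly P t"
        unfolding J_def by blast
      moreover have "(\<lambda>x. poly Q (x N)) \<in> poly_funs (Suc N)"
        unfolding poly_altdef
        by (intro poly_funs_sum poly_funs.mult poly_funs.const poly_funs_power poly_funs.coord) simp
      ultimately show ?thesis
        unfolding J_def
        by (auto intro!: bexI[of _ "\<lambda>x. f x * poly Q (x N)"] poly_funs.mult simp: line_N)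
    qed
    ultimately obtain g where g: "g \<in> J" "\<And>P. P \<in> J \<Longrightarrow> g dvd P"
      using principal_ideal_of_polys by metis
    \<comment> \<open>A root of the generator would be a point of \<open>Z\<close> on the line.\<close>
    have "poly g t \<noteq> 0" for t
    proof
      assume root: "poly g t = 0"
      have "s (line t) = 0" if s: "s \<in> S" for s
      proof -
        obtain P where P: "\<forall>t. s (line t) = poly P t" using on_line S(1) s by blast
        have "\<forall>x\<in>Z. s x = 0" using S(2) s by (auto simp: zero_set_def)
        then have "P \<in> J" using P S(1) s unfolding J_def by blast
        then have "g dvd P" by (rule g(2))
        then show ?thesis using P root by (auto simp: dvd_def)
      qed
      then have "line t \<in> Z" using S(2) line_in by (auto simp: zero_set_def)
      then show False using line_notin by blast
    qed
    then have "degree g = 0" using alg_closed_imp_poly_has_root[of g] by blast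
    then obtain \<gamma> where \<gamma>: "g = [:\<gamma>:]" by (meson degree_eq_zeroE)
    with \<open>\<And>t. poly g t \<noteq> 0\<close> have "\<gamma> \<noteq> 0" by simp
    from g(1) obtain q0 where q0: "q0 \<in> poly_funs (Suc N)" "\<forall>x\<in>Z. q0 x = 0" "\<forall>t. q0 (line t) = \<gamma>"
      unfolding J_def \<gamma> by auto
    define q where "q = (\<lambda>x. inverse \<gamma> * q0 x)"
    have q: "q \<in> poly_funs (Suc N)" "\<And>x. x \<in> Z \<Longrightarrow> q x = 0" "\<And>t. q (line t) = 1"
      using q0 \<open>\<gamma> \<noteq> 0\<close> by (auto simp: q_def intro: poly_funs.mult poly_funs.const)
    obtain k where "poly_deg_le (Suc N) k q" using poly_funs_imp_poly_deg_le[OF q(1)] by blast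
    from top_form_exists[OF this] v obtain c where c: "\<And>i. poly_deg_le N k (c i)"
      "\<And>x. q x = (\<Sum>i\<le>k. c i (?\<pi> x) * x N ^ i)"
      by metis
    have cb: "c i b = (if i = 0 then 1 else 0)" if "i \<le> k" for i
    proof -
      have "poly (\<Sum>i\<le>k. monom (c i b) i) t = poly 1 t" for t
        using c(2)[of "line t"] q(3)[of t] by (simp add: line_\<pi> line_N poly_sum poly_monom)
      then have "poly (\<Sum>i\<le>k. monom (c i b) i) = poly 1"
        by (rule ext)
      then have "(\<Sum>i\<le>k. monom (c i b) i) = 1"
        by (simp only: poly_eq_poly_eq_iff)
      from arg_cong[OF this, of "\<lambda>P. coeff P i"] that show ?thesis
        by (simp add: coeff_sum)
    qed
    \<comment> \<open>The \<open>j\<close>-th equation is \<open>x\<^sub>N\<^sup>j q = 0\<close>, rewritten in the powers up to \<open>e\<close>; over \<open>b\<close> the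
      system is the identity matrix because \<open>q = 1\<close> there.\<close>
    define M where "M = (\<lambda>j l y. \<Sum>i\<le>k. c i y * reduced_power a e (i + j) l y)"
    show ?thesis
    proof (rule eliminate_powers[where M = M and e = e and t = "\<lambda>x. x N"])
      show "M j i \<in> poly_funs N" for j i
        unfolding M_def
        by (intro poly_funs_sum poly_funs.mult poly_funs_reduced_power a poly_deg_le_imp_poly_funs[OF c(1)])
      show "M j l b = (if l = j then 1 else 0)" if "j \<le> e" "l \<le> e" for j l
      proof -
        have "M j l b = (\<Sum>i\<le>k. if i = 0 then reduced_power a e j l b else 0)"
          unfolding M_def by (rule sum.cong) (auto simp: cb)
        then show ?thesis using reduced_power_small[OF that, of a b] by simp
      qed
      show "(\<Sum>l\<le>e. M j l (?\<pi> x) * x N ^ l) = 0" if x: "x \<in> Z" and "j \<le> e" for x j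
      proof -
        have "(\<Sum>l\<le>e. M j l (?\<pi> x) * x N ^ l) =
            (\<Sum>l\<le>e. \<Sum>i\<le>k. c i (?\<pi> x) * (reduced_power a e (i + j) l (?\<pi> x) * x N ^ l))"
          by (simp add: M_def sum_distrib_right mult.assoc)
        also have "\<dots> = (\<Sum>i\<le>k. c i (?\<pi> x) * (\<Sum>l\<le>e. reduced_power a e (i + j) l (?\<pi> x) * x N ^ l))"
          by (subst sum.swap) (simp add: sum_distrib_left)
        also have "\<dots> = (\<Sum>i\<le>k. c i (?\<pi> x) * x N ^ (i + j))"
          by (simp only: power_eq_reduced_power[where a = a and e = e, OF integral[OF x], symmetric])
        also have "\<dots> = q x * x N ^ j"
          by (simp add: c(2) sum_distrib_right power_add mult.assoc)
        finally show ?thesis using q(2)[OF x] by simp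
      qed
    qed
  qed
  let ?R = "{r \<in> poly_funs N. \<forall>x\<in>Z. r (?\<pi> x) = 0}"
  have "?\<pi> ` Z = zero_set N ?R"
  proof
    show "?\<pi> ` Z \<subseteq> zero_set N ?R"
      by (auto simp: zero_set_def project_along_in_affine_points)
    show "zero_set N ?R \<subseteq> ?\<pi> ` Z"
    proof
      fix b assume b: "b \<in> zero_set N ?R"
      show "b \<in> ?\<pi> ` Z"
      proof (rule ccontr)
        assume "b \<notin> ?\<pi> ` Z"
        moreover have "b \<in> affine_points N" using b by (simp add: zero_set_def)
        ultimately obtain r where "r \<in> poly_funs N" "r b \<noteq> 0" "\<forall>x\<in>Z. r (?\<pi> x) = 0"
          using separate[of b] by auto
        then show False using b by (simp add: zero_set_def)
      qed
    qed
  qed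
  then show ?thesis unfolding closedin_zariski by (intro exI[of _ ?R]) auto
qed


section \<open>Growth of the coordinate ring\<close>

text \<open>
  The restrictions of the functions in \<open>F\<close> to \<open>Z\<close> span a space of dimension at most \<open>K\<close>.  Taking
  for \<open>F\<close> the polynomials of degree at most \<open>d\<close>, this bounds the Hilbert function of \<open>Z\<close> at \<open>d\<close> from
  above.  The spanning functions in \<open>B\<close> are arbitrary.
\<close>

definition spanned_on :: "'x set \<Rightarrow> ('x \<Rightarrow> 'k::field) set \<Rightarrow> nat \<Rightarrow> bool" where
  "spanned_on Z F K \<longleftrightarrow>
     (\<exists>B. finite B \<and> card B \<le> K \<and> (\<forall>f\<in>F. \<exists>a. \<forall>x\<in>Z. f x = (\<Sum>b\<in>B. a b * b x)))"

lemma spanned_onI_family: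
  assumes J: "finite J" "card J \<le> K"
    and span: "\<And>f. f \<in> F \<Longrightarrow> \<exists>a. \<forall>x\<in>Z. f x = (\<Sum>j\<in>J. a j * g j x)"
  shows "spanned_on Z F K"
  unfolding spanned_on_def
proof (intro exI[of _ "g ` J"] conjI ballI)
  show "finite (g ` J)" using J by simp
  show "card (g ` J) \<le> K" using J card_image_le le_trans by blast
  fix f assume "f \<in> F"
  then obtain a where a: "\<forall>x\<in>Z. f x = (\<Sum>j\<in>J. a j * g j x)" using span by blast
  define a' where "a' = (\<lambda>b. \<Sum>j\<in>{j \<in> J. g j = b}. a j)"
  have "(\<Sum>j\<in>J. a j * g j x) = (\<Sum>b\<in>g ` J. a' b * b x)" for x
  proof -
    have "(\<Sum>j\<in>J. a j * g j x) = (\<Sum>b\<in>g ` J. \<Sum>j\<in>{j \<in> J. g j = b}. a j * g j x)"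
      by (rule sum.image_gen[OF J(1)])
    also have "\<dots> = (\<Sum>b\<in>g ` J. a' b * b x)"
      unfolding a'_def sum_distrib_right by (intro sum.cong) auto
    finally show ?thesis .
  qed
  with a show "\<exists>a. \<forall>x\<in>Z. f x = (\<Sum>b\<in>g ` J. a b * b x)" by auto
qed

lemma spanned_on_subset: "spanned_on Z F K \<Longrightarrow> Z' \<subseteq> Z \<Longrightarrow> spanned_on Z' F K"
  unfolding spanned_on_def by (meson subsetD)

text \<open>
  If the functions of \<open>F\<close> are polynomials of degree at most \<open>k\<close> in \<open>t\<close> over the functions pulled back
  from the base, then the products of a spanning family of the base with \<open>1, t, \<dots>, t\<^sup>k\<close> span.
\<close>

lemma spanned_on_polynomial_extension:
  assumes base: "spanned_on (\<pi> ` Z) F' K"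
    and exp: "\<And>f. f \<in> F \<Longrightarrow> \<exists>c. (\<forall>i\<le>k. c i \<in> F') \<and> (\<forall>x\<in>Z. f x = (\<Sum>i\<le>k. c i (\<pi> x) * t x ^ i))"
  shows "spanned_on Z F (Suc k * K)"
proof -
  from base obtain B where B: "finite B" "card B \<le> K"
    and "\<forall>f\<in>F'. \<exists>a. \<forall>y\<in>\<pi> ` Z. f y = (\<Sum>b\<in>B. a b * b y)"
    unfolding spanned_on_def by blast
  then have span: "\<exists>a. \<forall>x\<in>Z. f (\<pi> x) = (\<Sum>b\<in>B. a b * b (\<pi> x))" if "f \<in> F'" for f
    using bspec[OF _ that] by (simp add: ball_simps)
  show ?thesis
  proof (rule spanned_onI_family[where J = "{..k} \<times> B" and g = "\<lambda>(i, b) x. b (\<pi> x) * t x ^ i"])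
    show "finite ({..k} \<times> B)" "card ({..k} \<times> B) \<le> Suc k * K"
      using B by (simp_all add: card_cartesian_product del: mult_Suc)
    fix f assume "f \<in> F"
    then obtain c where c: "\<forall>i\<le>k. c i \<in> F'" "\<forall>x\<in>Z. f x = (\<Sum>i\<le>k. c i (\<pi> x) * t x ^ i)"
      using exp by blast
    then have "\<forall>i. \<exists>a. i \<le> k \<longrightarrow> (\<forall>x\<in>Z. c i (\<pi> x) = (\<Sum>b\<in>B. a b * b (\<pi> x)))"
      using span by blast
    then obtain a where a: "\<And>i x. i \<le> k \<Longrightarrow> x \<in> Z \<Longrightarrow> c i (\<pi> x) = (\<Sum>b\<in>B. a i b * b (\<pi> x))"
      by metis
    have "f x = (\<Sum>j\<in>{..k} \<times> B. (case j of (i, b) \<Rightarrow> a i b) *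
        (case j of (i, b) \<Rightarrow> \<lambda>x. b (\<pi> x) * t x ^ i) x)" if "x \<in> Z" for x
    proof -
      have "f x = (\<Sum>i\<le>k. \<Sum>b\<in>B. a i b * (b (\<pi> x) * t x ^ i))"
        using c(2) a that by (simp add: sum_distrib_right mult.assoc)
      then show ?thesis by (simp add: sum.cartesian_product case_prod_beta)
    qed
    then show "\<exists>a. \<forall>x\<in>Z. f x = (\<Sum>j\<in>{..k} \<times> B. a j * (case j of (i, b) \<Rightarrow> \<lambda>x. b (\<pi> x) * t x ^ i) x)"
      by (intro exI[of _ "\<lambda>j. case j of (i, b) \<Rightarrow> a i b"]) blast
  qed
qed

lemma spanned_on_affine_points:
  "spanned_on (affine_points N) {f. poly_deg_le N d f} (Suc d ^ N)"
proof (induction N)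
  case 0
  show ?case
  proof (rule spanned_onI_family[where J = "{()}" and g = "\<lambda>_ _. 1"])
    fix f :: "(nat \<Rightarrow> 'a) \<Rightarrow> 'a" assume "f \<in> {f. poly_deg_le 0 d f}"
    then have "f \<in> poly_funs 0" using poly_deg_le_imp_poly_funs by blast
    then have "f x = f undefined" for x by (rule poly_funs_cong) simp
    then show "\<exists>a. \<forall>x\<in>affine_points 0. f x = (\<Sum>j\<in>{()}. a j * 1)"
      by (intro exI[of _ "\<lambda>_. f undefined"]) simp
  qed simp_all
next
  case (Suc N)
  define v where "v = (\<lambda>_::nat. 1::'a)"
  have vN: "v N = 1" by (simp add: v_def)
  have "project_along v N ` affine_points (Suc N) \<subseteq> affine_points N"
    using project_along_in_affine_points by blast
  then have base: "spanned_on (project_along v N ` affine_points (Suc N)) {f. poly_deg_le N d f} (Suc d ^ N)"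
    by (rule spanned_on_subset[OF Suc])
  have "spanned_on (affine_points (Suc N)) {f. poly_deg_le (Suc N) d (f :: (nat \<Rightarrow> 'a) \<Rightarrow> 'a)} (Suc d * Suc d ^ N)"
  proof (rule spanned_on_polynomial_extension[OF base, where t = "\<lambda>x. x N"])
    fix f :: "(nat \<Rightarrow> 'a) \<Rightarrow> 'a" assume "f \<in> {f. poly_deg_le (Suc N) d f}"
    then have "poly_deg_le (Suc N) d f" by simp
    from top_form_exists[OF this] obtain c where
      "\<forall>i. poly_deg_le N d (c i)" "\<forall>x. f x = (\<Sum>i\<le>d. c i (project_along v N x) * x N ^ i)"
      using vN by blast
    then show "\<exists>c. (\<forall>i\<le>d. c i \<in> {f. poly_deg_le N d f}) \<and>
        (\<forall>x\<in>affine_points (Suc N). f x = (\<Sum>i\<le>d. c i (project_along v N x) * x N ^ i))"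
      by blast
  qed
  then show ?case by simp
qed

text \<open>
  The Hilbert function of \<open>Z\<close> at \<open>D m\<close> is at least \<open>(m + 1)\<^sup>n / c\<close>.  For an algebraic set this says that
  its dimension is at least \<open>n\<close>, in a form that survives finite projections: these change only the
  constants \<open>c\<close> and \<open>D\<close>.
\<close>

definition has_growth :: "nat \<Rightarrow> (nat \<Rightarrow> 'k::field) set \<Rightarrow> nat \<Rightarrow> bool" where
  "has_growth N Z n \<longleftrightarrow>
     (\<exists>c D. \<forall>m K. spanned_on Z {f. poly_deg_le N (D * m) f} K \<longrightarrow> (m + 1) ^ n \<le> c * K)"

lemma has_growth_nonempty:
  assumes "has_growth N Z n"
  shows "Z \<noteq> {}"
proof
  assume "Z = {}"
  then have "spanned_on Z F 0" for F :: "((nat \<Rightarrow> 'a) \<Rightarrow> 'a) set"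
    unfolding spanned_on_def by (intro exI[of _ "{}"]) simp
  then show False using assms unfolding has_growth_def by fastforce
qed

text \<open>
  The Hilbert function of affine \<open>N\<close>-space is bounded by a polynomial of degree \<open>N\<close>.
\<close>

lemma has_growth_affine_points_le:
  assumes "has_growth N (affine_points N :: (nat \<Rightarrow> 'k::field) set) n"
  shows "n \<le> N"
proof (rule ccontr)
  assume "\<not> n \<le> N"
  from assms obtain c D where cD:
    "\<And>m K. spanned_on (affine_points N :: (nat \<Rightarrow> 'k) set) {f. poly_deg_le N (D * m) f} K \<Longrightarrow> (m + 1) ^ n \<le> c * K"
    unfolding has_growth_def by blast
  \<comment> \<open>For this \<open>m\<close>, growth of order \<open>N + 1\<close> would give \<open>(m + 1)\<^sup>N\<^sup>+\<^sup>1 \<le> m (m + 1)\<^sup>N\<close>.\<close>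
  define m where "m = c * (D + 1) ^ N"
  have "(m + 1) ^ Suc N \<le> (m + 1) ^ n"
    using \<open>\<not> n \<le> N\<close> by (intro power_increasing) auto
  also have "\<dots> \<le> c * Suc (D * m) ^ N"
    by (rule cD[OF spanned_on_affine_points])
  also have "\<dots> \<le> c * ((D + 1) * (m + 1)) ^ N"
    by (intro mult_left_mono power_mono) auto
  also have "\<dots> = m * (m + 1) ^ N"
    by (simp only: m_def power_mult_distrib mult.assoc)
  finally show False by simp
qed

text \<open>
  Dividing by the monic equation writes a polynomial of degree \<open>d\<close> on \<open>Z\<close> as a combination of
  \<open>1, x\<^sub>N, \<dots>, x\<^sub>N\<^sup>e\<close> whose coefficients come from the image and have degree linear in \<open>d\<close>.  So the
  Hilbert function of \<open>Z\<close> is at most \<open>e + 1\<close> times that of the image at a multiple of \<open>d\<close>.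
\<close>

lemma has_growth_project_along:
  fixes Z :: "(nat \<Rightarrow> 'k::field) set"
  assumes growth: "has_growth (Suc N) Z n" and v: "v N = 1" and a: "\<And>i. a i \<in> poly_funs N"
    and integral: "\<And>x. x \<in> Z \<Longrightarrow> x N ^ Suc e = (\<Sum>i\<le>e. a i (project_along v N x) * x N ^ i)"
  shows "has_growth N (project_along v N ` Z) n"
proof -
  let ?\<pi> = "project_along v N"
  obtain E where E: "\<And>i. i \<in> {..e} \<Longrightarrow> poly_deg_le N E (a i)"
    using finite_family_poly_deg_le[of "{..e}" a N] a by blast
  \<comment> \<open>The coefficients beyond \<open>a\<^sub>e\<close> do not enter the equation; setting them to zero gives all of them a
    common degree bound.\<close>
  define a' where "a' = (\<lambda>i. if i \<le> e then a i else (\<lambda>_. 0))"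
  have a'_deg: "poly_deg_le N E (a' i)" for i
    using E by (auto simp: a'_def intro: poly_deg_le.const)
  have a'_integral: "x N ^ Suc e = (\<Sum>i\<le>e. a' i (?\<pi> x) * x N ^ i)" if "x \<in> Z" for x
    unfolding integral[OF that] by (rule sum.cong) (auto simp: a'_def)
  have extend: "spanned_on Z {f. poly_deg_le (Suc N) d f} (Suc e * K)"
    if "spanned_on (?\<pi> ` Z) {f. poly_deg_le N (Suc E * d) f} K" for d K
    using that
  proof (rule spanned_on_polynomial_extension[where t = "\<lambda>x. x N"])
    fix f :: "(nat \<Rightarrow> 'k) \<Rightarrow> 'k" assume "f \<in> {f. poly_deg_le (Suc N) d f}"
    then have "poly_deg_le (Suc N) d f" by simp
    from top_form_exists[OF this] v obtain b where b: "\<forall>i. poly_deg_le N d (b i)"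
      "\<forall>x. f x = (\<Sum>i\<le>d. b i (?\<pi> x) * x N ^ i)"
      by blast
    define c where "c = (\<lambda>l y. \<Sum>i\<le>d. b i y * reduced_power a' e i l y)"
    have "poly_deg_le N (Suc E * d) (\<lambda>y. b i y * reduced_power a' e i l y)" if "i \<le> d" for i l
    proof (rule poly_deg_le_mono)
      show "poly_deg_le N (d + i * E) (\<lambda>y. b i y * reduced_power a' e i l y)"
        using b(1) by (intro poly_deg_le_mult poly_deg_le_reduced_power a'_deg) blast
      show "d + i * E \<le> Suc E * d" using that by (simp add: mult.commute)
    qed
    then have "poly_deg_le N (Suc E * d) (c l)" for l
      unfolding c_def by (intro poly_deg_le_sum) simp
    moreover have "f x = (\<Sum>l\<le>e. c l (?\<pi> x) * x N ^ l)" if x: "x \<in> Z" for x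
    proof -
      have "(\<Sum>l\<le>e. c l (?\<pi> x) * x N ^ l) =
          (\<Sum>l\<le>e. \<Sum>i\<le>d. b i (?\<pi> x) * (reduced_power a' e i l (?\<pi> x) * x N ^ l))"
        by (simp add: c_def sum_distrib_right mult.assoc)
      also have "\<dots> = (\<Sum>i\<le>d. b i (?\<pi> x) * (\<Sum>l\<le>e. reduced_power a' e i l (?\<pi> x) * x N ^ l))"
        by (subst sum.swap) (simp add: sum_distrib_left)
      also have "\<dots> = (\<Sum>i\<le>d. b i (?\<pi> x) * x N ^ i)"
        by (simp only: power_eq_reduced_power[where a = a' and e = e, OF a'_integral[OF x], symmetric])
      finally show ?thesis using b(2) by simp
    qed
    ultimately show "\<exists>c. (\<forall>i\<le>e. c i \<in> {f. poly_deg_le N (Suc E * d) f}) \<and>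
        (\<forall>x\<in>Z. f x = (\<Sum>i\<le>e. c i (?\<pi> x) * x N ^ i))"
      by blast
  qed
  from growth obtain c D where cD:
    "\<And>m K. spanned_on Z {f. poly_deg_le (Suc N) (D * m) f} K \<Longrightarrow> (m + 1) ^ n \<le> c * K"
    unfolding has_growth_def by blast
  show ?thesis
    unfolding has_growth_def
  proof (rule exI[of _ "c * Suc e"], rule exI[of _ "Suc E * D"], intro allI impI)
    fix m K :: nat
    assume "spanned_on (?\<pi> ` Z) {f. poly_deg_le N (Suc E * D * m) f} K"
    then have "spanned_on Z {f. poly_deg_le (Suc N) (D * m) f} (Suc e * K)"
      by (intro extend) (simp only: mult.assoc)
    then show "(m + 1) ^ n \<le> c * Suc e * K"
      using cD by (metis mult.assoc)
  qed
qed


section \<open>Noether normalization\<close>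

text \<open>
  A closed set on which no nonzero polynomial vanishes is the whole affine space.  Its growth then
  bounds \<open>n\<close> by the number of coordinates, and a coordinate projection is surjective.
\<close>

lemma affine_points_surjection:
  fixes Z :: "(nat \<Rightarrow> 'k::field) set"
  assumes Z: "closedin (zariski N) Z" and growth: "has_growth N Z n"
    and dense: "\<And>p x. p \<in> poly_funs N \<Longrightarrow> (\<forall>z\<in>Z. p z = 0) \<Longrightarrow> p x = 0"
  shows "\<exists>G. (\<forall>i<n. G i \<in> poly_funs N) \<and> (\<forall>y\<in>affine_points n. \<exists>z\<in>Z. \<forall>i<n. G i z = y i)"
proof -
  obtain S where S: "S \<subseteq> poly_funs N" "Z = zero_set N S"
    using Z unfolding closedin_zariski by blast
  have "p x = 0" if "p \<in> S" for p x
    using dense[of p x] S that by (auto simp: zero_set_def)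
  then have Z_eq: "Z = affine_points N" unfolding S(2) by (auto simp: zero_set_def)
  have "n \<le> N" using has_growth_affine_points_le growth unfolding Z_eq by blast
  show ?thesis
  proof (intro exI[of _ "\<lambda>i x. x i"] conjI allI ballI impI)
    fix i assume "i < n"
    then show "(\<lambda>x. x i) \<in> poly_funs N" using \<open>n \<le> N\<close> by (auto intro: poly_funs.coord)
  next
    fix y :: "nat \<Rightarrow> 'k" assume "y \<in> affine_points n"
    show "\<exists>z\<in>Z. \<forall>i<n. z i = y i"
      unfolding Z_eq using \<open>n \<le> N\<close>
      by (intro bexI[of _ "\<lambda>i\<in>{..<N}. y i"]) (auto simp: affine_points_def)
  qed
qed

text \<open>
  As long as a nonzero polynomial vanishes on \<open>Z\<close>, project along a direction in which it is monic: the
  image is again closed, its growth is no smaller, and it lies in a space with one coordinate fewer.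
  The process stops at a full affine space of dimension at least \<open>n\<close>.
\<close>

lemma noether_normalization:
  fixes Z :: "(nat \<Rightarrow> 'k::{alg_closed_field, field_char_0}) set"
  assumes "closedin (zariski N) Z" "has_growth N Z n"
  shows "\<exists>G. (\<forall>i<n. G i \<in> poly_funs N) \<and> (\<forall>y\<in>affine_points n. \<exists>z\<in>Z. \<forall>i<n. G i z = y i)"
  using assms
proof (induction N arbitrary: Z)
  case 0
  show ?case
  proof (rule affine_points_surjection[OF 0])
    fix p :: "(nat \<Rightarrow> 'k) \<Rightarrow> 'k" and x
    assume p: "p \<in> poly_funs 0" "\<forall>z\<in>Z. p z = 0"
    from has_growth_nonempty[OF "0"(2)] obtain z where "z \<in> Z" by blast
    with p poly_funs_cong[OF p(1), of x z] show "p x = 0" by simp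
  qed
next
  case (Suc N)
  show ?case
  proof (cases "\<forall>p x. p \<in> poly_funs (Suc N) \<longrightarrow> (\<forall>z\<in>Z. p z = 0) \<longrightarrow> p x = 0")
    case True
    then show ?thesis by (intro affine_points_surjection[OF Suc.prems]) blast
  next
    case False
    then obtain p x0 where p: "p \<in> poly_funs (Suc N)" "\<forall>z\<in>Z. p z = 0" "p x0 \<noteq> 0" by blast
    obtain v e a where v: "v N = 1" and a: "\<And>i. a i \<in> poly_funs N"
      and p_int: "\<And>x. p x = 0 \<Longrightarrow> x N ^ Suc e = (\<Sum>i\<le>e. a i (project_along v N x) * x N ^ i)"
      by (rule exists_monic_direction[OF p(1,3)]) (rule that)
    have int: "x N ^ Suc e = (\<Sum>i\<le>e. a i (project_along v N x) * x N ^ i)" if "x \<in> Z" for x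
      by (rule p_int) (use p(2) that in blast)
    let ?\<pi> = "project_along v N"
    have "closedin (zariski N) (?\<pi> ` Z)"
      by (rule closed_projection[where a = a and e = e, OF Suc.prems(1) v a int])
    moreover have "has_growth N (?\<pi> ` Z) n"
      by (rule has_growth_project_along[where a = a and e = e, OF Suc.prems(2) v a int])
    ultimately obtain G where G: "\<forall>i<n. G i \<in> poly_funs N"
      "\<forall>y\<in>affine_points n. \<exists>z\<in>?\<pi> ` Z. \<forall>i<n. G i z = y i"
      using Suc.IH by blast
    show ?thesis
    proof (intro exI[of _ "\<lambda>i x. G i (?\<pi> x)"] conjI allI impI ballI)
      show "(\<lambda>x. G i (?\<pi> x)) \<in> poly_funs (Suc N)" if "i < n" for i
        using G(1) that by (intro poly_funs_project_along) blast
      show "\<exists>z\<in>Z. \<forall>i<n. G i (?\<pi> z) = y i" if "y \<in> affine_points n" for y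
        using G(2) that by blast
    qed
  qed
qed


section \<open>Algebraic independence along a chain\<close>

text \<open>
  The polynomials in \<open>n\<close> variables of degree at most \<open>m\<close> in each of them are encoded as coefficient
  functions \<open>a\<close> on the box of exponent vectors \<open>{..<n} \<rightarrow>\<^sub>E {..m}\<close>.  Boxes make the number of monomials
  the power \<open>(m + 1)\<^sup>n\<close> and separate the last variable easily.
\<close>

definition alg_independent_on ::
    "'x set \<Rightarrow> nat \<Rightarrow> (nat \<Rightarrow> 'x \<Rightarrow> 'k::field) \<Rightarrow> bool" where
  "alg_independent_on Z n f \<longleftrightarrow>
     (\<forall>m a. (\<forall>x\<in>Z. (\<Sum>\<alpha>\<in>{..<n} \<rightarrow>\<^sub>E {..m}. a \<alpha> * (\<Prod>i<n. f i x ^ \<alpha> i)) = 0) \<longrightarrow>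
        (\<forall>\<alpha>\<in>{..<n} \<rightarrow>\<^sub>E {..m}. a \<alpha> = 0))"

text \<open>
  A homogeneous system with more unknowns than equations has a nontrivial solution; one unknown is
  eliminated for each equation.
\<close>

lemma nontrivial_relation:
  fixes M :: "'i \<Rightarrow> 'j \<Rightarrow> 'k::field"
  assumes "finite B" "finite A" "card B < card A"
  shows "\<exists>c. (\<exists>i\<in>A. c i \<noteq> 0) \<and> (\<forall>j\<in>B. (\<Sum>i\<in>A. c i * M i j) = 0)"
  using assms
proof (induction B arbitrary: A M rule: finite_induct)
  case empty
  then have "A \<noteq> {}" by auto
  then show ?case by (intro exI[of _ "\<lambda>_. 1"]) auto
next
  case (insert l B)
  show ?case
  proof (cases "\<forall>i\<in>A. M i l = 0")
    case True
    have "card B < card A" using insert by simp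
    then obtain c where "\<exists>i\<in>A. c i \<noteq> 0" "\<forall>j\<in>B. (\<Sum>i\<in>A. c i * M i j) = 0"
      using insert.IH[OF insert.prems(1)] by blast
    then show ?thesis using True by (intro exI[of _ c]) auto
  next
    case False
    then obtain p where p: "p \<in> A" "M p l \<noteq> 0" by blast
    define A' where "A' = A - {p}"
    have A: "A = insert p A'" "p \<notin> A'" "finite A'" using p insert.prems by (auto simp: A'_def)
    \<comment> \<open>Equation \<open>l\<close> determines the unknown \<open>p\<close> from the others; substituting it leaves the system \<open>M'\<close>.\<close>
    define M' where "M' = (\<lambda>i j. M i j - M i l / M p l * M p j)"
    have "card B < card A'" using insert.prems insert.hyps A by simp
    from insert.IH[OF A(3) this, of M'] obtain c where
      c: "\<exists>i\<in>A'. c i \<noteq> 0" "\<forall>j\<in>B. (\<Sum>i\<in>A'. c i * M' i j) = 0"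
      by blast
    define c' where "c' = c(p := - (\<Sum>i\<in>A'. c i * (M i l / M p l)))"
    have "(\<Sum>i\<in>A. c' i * M i j) = (\<Sum>i\<in>A'. c i * M' i j)" for j
    proof -
      have "(\<Sum>i\<in>A. c' i * M i j) = c' p * M p j + (\<Sum>i\<in>A'. c' i * M i j)"
        using A by simp
      also have "(\<Sum>i\<in>A'. c' i * M i j) = (\<Sum>i\<in>A'. c i * M i j)"
        using A(2) by (intro sum.cong) (auto simp: c'_def)
      finally show ?thesis
        by (simp add: c'_def M'_def right_diff_distrib sum_subtractf sum_distrib_right mult.assoc)
    qed
    moreover have "M' i l = 0" for i using p(2) by (simp add: M'_def)
    ultimately have "\<forall>j\<in>insert l B. (\<Sum>i\<in>A. c' i * M i j) = 0" using c(2) by simp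
    moreover have "\<exists>i\<in>A. c' i \<noteq> 0" using c(1) A by (auto simp: c'_def)
    ultimately show ?thesis by blast
  qed
qed

text \<open>
  The monomials in \<open>f\<close> with exponents at most \<open>m\<close> are \<open>(m + 1)\<^sup>n\<close> linearly independent functions whose
  degrees are bounded by a multiple of \<open>m\<close>.
\<close>

lemma alg_independent_on_imp_growth:
  fixes f :: "nat \<Rightarrow> (nat \<Rightarrow> 'k::field) \<Rightarrow> 'k"
  assumes f: "\<And>i. i < n \<Longrightarrow> f i \<in> poly_funs N" and indep: "alg_independent_on Z n f"
  shows "has_growth N Z n"
proof -
  obtain d where d: "\<And>i. i \<in> {..<n} \<Longrightarrow> poly_deg_le N d (f i)"
    using finite_family_poly_deg_le[of "{..<n}" f N] f by blast
  have "(m + 1) ^ n \<le> K" if span: "spanned_on Z {p. poly_deg_le N (n * d * m) p} K" for m K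
  proof (rule ccontr)
    assume less: "\<not> (m + 1) ^ n \<le> K"
    define A where "A = {..<n} \<rightarrow>\<^sub>E {..m}"
    have A: "finite A" "card A = (m + 1) ^ n"
      by (simp_all add: A_def finite_PiE card_PiE)
    define \<mu> where "\<mu> = (\<lambda>\<alpha> x. \<Prod>i<n. f i x ^ \<alpha> i)"
    have "poly_deg_le N (n * d * m) (\<mu> \<alpha>)" if "\<alpha> \<in> A" for \<alpha>
    proof (rule poly_deg_le_mono)
      show "poly_deg_le N (\<Sum>i<n. \<alpha> i * d) (\<mu> \<alpha>)"
        unfolding \<mu>_def by (intro poly_deg_le_prod poly_deg_le_power d)
      have "(\<Sum>i<n. \<alpha> i * d) \<le> (\<Sum>i<n. m * d)"
        using that by (intro sum_mono mult_right_mono) (auto simp: A_def)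
      then show "(\<Sum>i<n. \<alpha> i * d) \<le> n * d * m" by (simp add: mult_ac)
    qed
    with span obtain B where B: "finite B" "card B \<le> K"
      "\<forall>\<alpha>\<in>A. \<exists>b. \<forall>x\<in>Z. \<mu> \<alpha> x = (\<Sum>g\<in>B. b g * g x)"
      unfolding spanned_on_def by blast
    then obtain M where M: "\<And>\<alpha> x. \<alpha> \<in> A \<Longrightarrow> x \<in> Z \<Longrightarrow> \<mu> \<alpha> x = (\<Sum>g\<in>B. M \<alpha> g * g x)"
      by metis
    have "card B < card A" using less A(2) B(2) by simp
    from nontrivial_relation[OF B(1) A(1) this, of M] obtain c where
      c: "\<exists>\<alpha>\<in>A. c \<alpha> \<noteq> 0" "\<forall>g\<in>B. (\<Sum>\<alpha>\<in>A. c \<alpha> * M \<alpha> g) = 0"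
      by blast
    have "(\<Sum>\<alpha>\<in>A. c \<alpha> * \<mu> \<alpha> x) = 0" if x: "x \<in> Z" for x
    proof -
      have "(\<Sum>\<alpha>\<in>A. c \<alpha> * \<mu> \<alpha> x) = (\<Sum>\<alpha>\<in>A. \<Sum>g\<in>B. c \<alpha> * M \<alpha> g * g x)"
        using M[OF _ x] by (simp add: sum_distrib_left mult.assoc)
      also have "\<dots> = (\<Sum>g\<in>B. (\<Sum>\<alpha>\<in>A. c \<alpha> * M \<alpha> g) * g x)"
        by (subst sum.swap) (simp add: sum_distrib_right)
      finally show ?thesis using c(2) by simp
    qed
    then have "\<forall>\<alpha>\<in>A. c \<alpha> = 0"
      using indep unfolding alg_independent_on_def A_def \<mu>_def by blast
    then show False using c(1) by blast
  qed
  then show ?thesis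
    unfolding has_growth_def by - (rule exI[of _ 1], rule exI[of _ "n * d"], simp)
qed

lemma sum_PiE_Suc:
  "(\<Sum>\<beta>\<in>{..<Suc n} \<rightarrow>\<^sub>E S. h \<beta>) = (\<Sum>j\<in>S. \<Sum>\<alpha>\<in>{..<n} \<rightarrow>\<^sub>E S. h (\<alpha>(n := j)))"
proof -
  have "{..<Suc n} \<rightarrow>\<^sub>E S = (\<lambda>(j, \<alpha>). \<alpha>(n := j)) ` (S \<times> ({..<n} \<rightarrow>\<^sub>E S))"
    unfolding lessThan_Suc by (rule PiE_insert_eq)
  moreover have "inj_on (\<lambda>(j, \<alpha>). \<alpha>(n := j)) (S \<times> ({..<n} \<rightarrow>\<^sub>E S))"
    using inj_combinator[of n "{..<n}" "\<lambda>_. S"] by simp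
  ultimately have "(\<Sum>\<beta>\<in>{..<Suc n} \<rightarrow>\<^sub>E S. h \<beta>) =
      (\<Sum>p\<in>S \<times> ({..<n} \<rightarrow>\<^sub>E S). h (case p of (j, \<alpha>) \<Rightarrow> \<alpha>(n := j)))"
    by (simp only: sum.reindex comp_def)
  then show ?thesis
    by (simp add: sum.cartesian_product case_prod_beta)
qed

text \<open>
  Suppose the functions \<open>f\<close> and \<open>g\<close> satisfied a relation on \<open>C'\<close>.  Since the coordinate ring of \<open>C'\<close> is
  a domain and \<open>g\<close> is nonzero in it, the lowest power of \<open>g\<close> in the relation can be cancelled.
  Restricted to \<open>C\<close>, where \<open>g\<close> vanishes, what remains is a relation between the \<open>f\<close> alone, given by the
  lowest coefficient.
\<close>

lemma alg_independent_on_extend: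
  fixes f :: "nat \<Rightarrow> (nat \<Rightarrow> 'k::field) \<Rightarrow> 'k"
  assumes f: "\<And>i. i < n \<Longrightarrow> f i \<in> poly_funs N" and indep: "alg_independent_on C n f"
    and g: "g \<in> poly_funs N" "\<And>x. x \<in> C \<Longrightarrow> g x = 0" and x0: "x0 \<in> C'" "g x0 \<noteq> 0"
    and sub: "C \<subseteq> C'"
    and domain: "\<And>p q. p \<in> poly_funs N \<Longrightarrow> q \<in> poly_funs N \<Longrightarrow> (\<forall>x\<in>C'. p x * q x = 0) \<Longrightarrow>
       (\<forall>x\<in>C'. p x = 0) \<or> (\<forall>x\<in>C'. q x = 0)"
  shows "alg_independent_on C' (Suc n) (f(n := g))"
  unfolding alg_independent_on_def
proof (intro allI impI)
  fix m :: nat and a :: "(nat \<Rightarrow> nat) \<Rightarrow> 'k"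
  let ?A = "{..<n} \<rightarrow>\<^sub>E {..m}"
  assume rel: "\<forall>x\<in>C'. (\<Sum>\<beta>\<in>{..<Suc n} \<rightarrow>\<^sub>E {..m}. a \<beta> * (\<Prod>i<Suc n. (f(n := g)) i x ^ \<beta> i)) = 0"
  \<comment> \<open>The coefficient of \<open>g\<^sup>i\<close> in the relation.\<close>
  define G where "G = (\<lambda>i x. \<Sum>\<alpha>\<in>?A. a (\<alpha>(n := i)) * (\<Prod>l<n. f l x ^ \<alpha> l))"
  have G_poly: "G i \<in> poly_funs N" for i
    unfolding G_def
    by (intro poly_funs_sum poly_funs.mult poly_funs.const poly_funs_prod poly_funs_power f) simp
  have rel': "(\<Sum>i\<le>m. G i x * g x ^ i) = 0" if x: "x \<in> C'" for x
  proof -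
    have "(\<Prod>l<Suc n. (f(n := g)) l x ^ (\<alpha>(n := i)) l) = (\<Prod>l<n. f l x ^ \<alpha> l) * g x ^ i" for \<alpha> i
      by simp
    then have "(\<Sum>i\<le>m. G i x * g x ^ i) =
        (\<Sum>\<beta>\<in>{..<Suc n} \<rightarrow>\<^sub>E {..m}. a \<beta> * (\<Prod>i<Suc n. (f(n := g)) i x ^ \<beta> i))"
      unfolding sum_PiE_Suc G_def by (simp only: sum_distrib_right mult.assoc)
    then show ?thesis using rel x by simp
  qed
  \<comment> \<open>Once the coefficients of the powers below \<open>g\<^sup>j\<close> are zero, the relation is \<open>g\<^sup>j H = 0\<close>, and \<open>H\<close>
    agrees with the coefficient of \<open>g\<^sup>j\<close> on \<open>C\<close>.\<close>
  have coeffs: "j \<le> m \<Longrightarrow> \<forall>\<alpha>\<in>?A. a (\<alpha>(n := j)) = 0" for j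
  proof (induction j rule: less_induct)
    case (less j)
    have G_low: "G i x = 0" if "i < j" for i x
    proof -
      have "\<forall>\<alpha>\<in>?A. a (\<alpha>(n := i)) = 0"
        using less.IH[OF that] that less.prems by linarith
      then show ?thesis unfolding G_def by (intro sum.neutral) (metis mult_zero_left)
    qed
    define H where "H = (\<lambda>x. \<Sum>i\<in>{j..m}. G i x * g x ^ (i - j))"
    have "g x ^ j * H x = 0" if "x \<in> C'" for x
    proof -
      have "g x ^ j * H x = (\<Sum>i\<in>{j..m}. G i x * g x ^ i)"
        unfolding H_def sum_distrib_left
        by (intro sum.cong) (auto simp: mult.left_commute power_add[symmetric])
      also have "\<dots> = (\<Sum>i\<le>m. G i x * g x ^ i)"
        by (rule sum.mono_neutral_left) (auto simp: G_low)
      finally show ?thesis using rel'[OF that] by simp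
    qed
    moreover have "H \<in> poly_funs N"
      unfolding H_def by (intro poly_funs_sum poly_funs.mult G_poly poly_funs_power g(1))
    ultimately have "(\<forall>x\<in>C'. g x ^ j = 0) \<or> (\<forall>x\<in>C'. H x = 0)"
      using domain[OF poly_funs_power[OF g(1)], of H j] by blast
    then have H_zero: "H x = 0" if "x \<in> C'" for x using x0 that by auto
    have "G j x = 0" if x: "x \<in> C" for x
    proof -
      have "H x = (\<Sum>i\<in>{j..m}. if i = j then G j x else 0)"
        unfolding H_def using g(2)[OF x] by (intro sum.cong) auto
      also have "\<dots> = G j x" using less.prems by simp
      finally show ?thesis using H_zero x sub by auto
    qed
    then show ?case
      using indep[unfolded alg_independent_on_def, rule_format, of "\<lambda>\<alpha>. a (\<alpha>(n := j))" m]
      unfolding G_def by blast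
  qed
  show "\<forall>\<beta>\<in>{..<Suc n} \<rightarrow>\<^sub>E {..m}. a \<beta> = 0"
    unfolding lessThan_Suc PiE_insert_eq using coeffs by auto
qed


lemma has_growth_mono:
  assumes "has_growth N Z n" "Z \<subseteq> Z'"
  shows "has_growth N Z' n"
  using assms unfolding has_growth_def by (meson spanned_on_subset)

text \<open>
  Each strict inclusion \<open>C n \<subset> C (n + 1)\<close> contributes one more independent function, namely a
  polynomial vanishing on the smaller set but not on the larger one.  The chain lives in an abstract
  space \<open>T\<close>, which \<open>\<phi>\<close> maps to affine space in such a way that closed sets are cut out by polynomials.
\<close>

lemma alg_independent_on_irreducible_chain:
  fixes \<phi> :: "'a \<Rightarrow> nat \<Rightarrow> 'k::field"
  assumes \<phi>: "continuous_map T (zariski N) \<phi>"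
    and closed_image: "\<And>A. closedin T A \<Longrightarrow>
       \<exists>S \<subseteq> poly_funs N. \<forall>x\<in>topspace T. x \<in> A \<longleftrightarrow> (\<forall>p\<in>S. p (\<phi> x) = 0)"
    and chain: "irreducible_chain T n C"
  shows "\<exists>f. (\<forall>i<n. f i \<in> poly_funs N) \<and> alg_independent_on (\<phi> ` C n) n f"
  using chain
proof (induction n)
  case 0
  then have "C 0 \<noteq> {}" by (simp add: irreducible_chain_def irreducible_closed_def)
  then have "alg_independent_on (\<phi> ` C 0) 0 f" for f
    by (auto simp: alg_independent_on_def)
  then show ?case by blast
next
  case (Suc n)
  let ?C = "C n" and ?C' = "C (Suc n)"
  have irr: "irreducible_closed T ?C" "irreducible_closed T ?C'" and sub: "?C \<subset> ?C'"
    and "irreducible_chain T n C"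
    using Suc.prems by (auto simp: irreducible_chain_def)
  then obtain f where f: "\<forall>i<n. f i \<in> poly_funs N" "alg_independent_on (\<phi> ` ?C) n f"
    using Suc.IH by blast
  have closed: "closedin T ?C" "closedin T ?C'" using irr by (simp_all add: irreducible_closed_def)
  then have in_T: "?C \<subseteq> topspace T" "?C' \<subseteq> topspace T" by (simp_all add: closedin_subset)
  obtain S where S: "S \<subseteq> poly_funs N" "\<forall>x\<in>topspace T. x \<in> ?C \<longleftrightarrow> (\<forall>p\<in>S. p (\<phi> x) = 0)"
    using closed_image[OF closed(1)] by blast
  obtain x1 where x1: "x1 \<in> ?C'" "x1 \<notin> ?C" using sub by blast
  then obtain g where g: "g \<in> S" "g (\<phi> x1) \<noteq> 0" using S(2) in_T by blast
  have closed_zero: "closedin T {x \<in> ?C'. p (\<phi> x) = 0}" if "p \<in> poly_funs N" for p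
  proof -
    have "closedin (zariski N) (zero_set N {p})"
      unfolding closedin_zariski using that by blast
    then have "closedin T ({x \<in> topspace T. \<phi> x \<in> zero_set N {p}} \<inter> ?C')"
      using \<phi> closed(2) by (intro closedin_Int closedin_continuous_map_preimage)
    moreover have "\<phi> x \<in> affine_points N" if "x \<in> topspace T" for x
      using continuous_map_image_subset_topspace[OF \<phi>] that by (auto simp: topspace_zariski)
    then have "{x \<in> topspace T. \<phi> x \<in> zero_set N {p}} \<inter> ?C' = {x \<in> ?C'. p (\<phi> x) = 0}"
      using in_T by (auto simp: zero_set_def)
    ultimately show ?thesis by simp
  qed
  have "alg_independent_on (\<phi> ` ?C') (Suc n) (f(n := g))"
  proof (rule alg_independent_on_extend[OF _ f(2)])
    show "f i \<in> poly_funs N" if "i < n" for i using f(1) that by blast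
    show "g \<in> poly_funs N" using g(1) S(1) by blast
    show "g x = 0" if "x \<in> \<phi> ` ?C" for x using S(2) g(1) in_T(1) that by blast
    show "\<phi> x1 \<in> \<phi> ` ?C'" "g (\<phi> x1) \<noteq> 0" using x1 g by simp_all
    show "\<phi> ` ?C \<subseteq> \<phi> ` ?C'" using sub by blast
    fix p q assume p: "p \<in> poly_funs N" and q: "q \<in> poly_funs N"
      and "\<forall>x\<in>\<phi> ` ?C'. p x * q x = 0"
    then have "?C' = {x \<in> ?C'. p (\<phi> x) = 0} \<union> {x \<in> ?C'. q (\<phi> x) = 0}" by auto
    then have "?C' = {x \<in> ?C'. p (\<phi> x) = 0} \<or> ?C' = {x \<in> ?C'. q (\<phi> x) = 0}"
      using irr(2) closed_zero[OF p] closed_zero[OF q] unfolding irreducible_closed_def by blast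
    then show "(\<forall>x\<in>\<phi> ` ?C'. p x = 0) \<or> (\<forall>x\<in>\<phi> ` ?C'. q x = 0)" by blast
  qed
  moreover have "\<forall>i<Suc n. (f(n := g)) i \<in> poly_funs N"
    using f(1) g(1) S(1) by (auto simp: less_Suc_eq)
  ultimately show ?case by blast
qed


section \<open>Polynomial maps as morphisms\<close>

lemma fun_morphism_in_points:
  "fun_morphism X Y \<phi> \<Longrightarrow> x \<in> points X \<Longrightarrow> \<phi> x \<in> points Y"
  unfolding fun_morphism_def using continuous_map_image_subset_topspace by blast

lemma fun_morphism_compose:
  assumes \<phi>: "fun_morphism X Y \<phi>" and \<psi>: "fun_morphism Y W \<psi>"
  shows "fun_morphism X W (\<lambda>x. \<psi> (\<phi> x))"
  unfolding fun_morphism_def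
proof (intro conjI allI impI)
  show "continuous_map (top_of X) (top_of W) (\<lambda>x. \<psi> (\<phi> x))"
    using \<phi> \<psi> continuous_map_compose[of "top_of X" "top_of Y" \<phi> "top_of W" \<psi>]
    by (simp add: fun_morphism_def comp_def)
  fix V h assume V: "openin (top_of W) V \<and> regular W V h"
  let ?U = "{y \<in> points Y. \<psi> y \<in> V}"
  have "openin (top_of Y) ?U"
    using \<psi> V openin_continuous_map_preimage unfolding fun_morphism_def by blast
  moreover have "regular Y ?U (\<lambda>y. h (\<psi> y))" using \<psi> V by (simp add: fun_morphism_def)
  ultimately have "regular X {x \<in> points X. \<phi> x \<in> ?U} (\<lambda>x. h (\<psi> (\<phi> x)))"
    using \<phi> unfolding fun_morphism_def by blast
  moreover have "{x \<in> points X. \<phi> x \<in> ?U} = {x \<in> points X. \<psi> (\<phi> x) \<in> V}"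
    using fun_morphism_in_points[OF \<phi>] by blast
  ultimately show "regular X {x \<in> points X. \<psi> (\<phi> x) \<in> V} (\<lambda>x. h (\<psi> (\<phi> x)))" by simp
qed

lemma top_of_affine_space: "top_of (affine_space n) = zariski n"
  unfolding affine_space_def affine_set_def
  by (simp add: subtopology_topspace flip: topspace_zariski)

lemma fun_morphism_poly_map:
  fixes G :: "nat \<Rightarrow> (nat \<Rightarrow> 'k::field) \<Rightarrow> 'k"
  assumes G: "\<And>i. i < n \<Longrightarrow> G i \<in> poly_funs N"
  shows "fun_morphism (affine_set N Z) (affine_space n) (\<lambda>x. \<lambda>i\<in>{..<n}. G i x)"
proof -
  define \<gamma> where "\<gamma> = (\<lambda>x. \<lambda>i\<in>{..<n}. G i x)"
  have \<gamma>_in: "\<gamma> x \<in> affine_points n" for x by (auto simp: \<gamma>_def affine_points_def)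
  have pull: "(\<lambda>x. p (\<gamma> x)) \<in> poly_funs N" if "p \<in> poly_funs n" for p
    by (rule poly_funs_compose[OF that]) (simp add: \<gamma>_def G)
  have cont_zariski: "continuous_map (zariski N) (zariski n) \<gamma>"
    unfolding continuous_map topspace_zariski
  proof (intro conjI allI impI)
    show "\<gamma> ` affine_points N \<subseteq> affine_points n" using \<gamma>_in by blast
    fix V :: "(nat \<Rightarrow> 'k) set" assume "openin (zariski n) V"
    then obtain S where S: "S \<subseteq> poly_funs n" "V = affine_points n - zero_set n S"
      unfolding openin_zariski by blast
    have "{x \<in> affine_points N. \<gamma> x \<in> V} =
        affine_points N - zero_set N ((\<lambda>p x. p (\<gamma> x)) ` S)"
      unfolding S(2) using \<gamma>_in by (auto simp: zero_set_def)
    moreover have "(\<lambda>p x. p (\<gamma> x)) ` S \<subseteq> poly_funs N" using S(1) pull by blast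
    ultimately show "openin (zariski N) {x \<in> affine_points N. \<gamma> x \<in> V}"
      unfolding openin_zariski by blast
  qed
  then have cont: "continuous_map (top_of (affine_set N Z)) (top_of (affine_space n)) \<gamma>"
    by (simp add: top_of_affine_space) (simp add: affine_set_def continuous_map_from_subtopology)
  have "regular (affine_set N Z) {x \<in> points (affine_set N Z). \<gamma> x \<in> V} (\<lambda>x. h (\<gamma> x))"
    if V: "openin (top_of (affine_space n)) V" "regular (affine_space n) V h" for V h
  proof -
    have "\<exists>W p q. openin (top_of (affine_set N Z)) W \<and> x \<in> W \<and>
        W \<subseteq> {x \<in> points (affine_set N Z). \<gamma> x \<in> V} \<and> p \<in> poly_funs N \<and> q \<in> poly_funs N \<and>
        (\<forall>y\<in>W. q y \<noteq> 0 \<and> h (\<gamma> y) = p y / q y)"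
      if x: "x \<in> points (affine_set N Z)" "\<gamma> x \<in> V" for x
    proof -
      obtain W p q where W: "openin (top_of (affine_space n)) W" "\<gamma> x \<in> W" "W \<subseteq> V"
        and pq: "p \<in> poly_funs n" "q \<in> poly_funs n" "\<forall>y\<in>W. q y \<noteq> 0 \<and> h y = p y / q y"
        using V(2) x(2) unfolding affine_space_def affine_set_def by auto
      show ?thesis
      proof (intro exI conjI)
        show "openin (top_of (affine_set N Z)) {x \<in> points (affine_set N Z). \<gamma> x \<in> W}"
          by (rule openin_continuous_map_preimage[OF cont W(1)])
        show "(\<lambda>x. p (\<gamma> x)) \<in> poly_funs N" "(\<lambda>x. q (\<gamma> x)) \<in> poly_funs N"
          using pull pq by blast+
      qed (use W pq x in auto)
    qed
    then show ?thesis unfolding affine_set_def by simp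
  qed
  then show ?thesis
    using cont unfolding fun_morphism_def \<gamma>_def by blast
qed

section \<open>Surjections onto affine space\<close>

text \<open>
  The variety is exchanged for an isomorphic closed subset \<open>Z\<close> of some affine space.  The image in \<open>Z\<close> of
  the largest member of a chain of length \<open>n\<close> already has growth \<open>n\<close>.
\<close>

theorem affine_variety_surjects_onto_affine_space:
  fixes X :: "('a, 'k::{alg_closed_field, field_char_0}) fun_space"
  assumes "affine_variety X" "has_dimension (top_of X) n"
  obtains g where "fun_morphism X (affine_space n) g" "g ` points X = points (affine_space n)"
proof -
  from assms(1) obtain N Z \<phi> \<psi> where Z: "closedin (zariski N) Z"
    and \<phi>: "fun_morphism X (affine_set N Z) \<phi>" and \<psi>: "fun_morphism (affine_set N Z) X \<psi>"
    and inv: "\<forall>x\<in>points X. \<psi> (\<phi> x) = x" "\<forall>z\<in>points (affine_set N Z). \<phi> (\<psi> z) = z"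
    unfolding affine_variety_def fun_isomorphic_def by blast
  have Z_sub: "Z \<subseteq> affine_points N" using closedin_subset[OF Z] by (simp add: topspace_zariski)
  have top: "top_of (affine_set N Z) = subtopology (zariski N) Z" by (simp add: affine_set_def)
  have points: "points (affine_set N Z) = Z" using Z_sub by (auto simp: top topspace_zariski)
  from assms(2) obtain C where chain: "irreducible_chain (top_of X) n C"
    unfolding has_dimension_def by blast
  have cont: "continuous_map (top_of X) (zariski N) \<phi>"
    using \<phi> by (simp add: fun_morphism_def top continuous_map_in_subtopology)
  have closed: "\<exists>S \<subseteq> poly_funs N. \<forall>x\<in>points X. x \<in> A \<longleftrightarrow> (\<forall>p\<in>S. p (\<phi> x) = 0)"
    if A: "closedin (top_of X) A" for A
  proof -
    have "closedin (subtopology (zariski N) Z) {z \<in> points (affine_set N Z). \<psi> z \<in> A}"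
      using \<psi> A closedin_continuous_map_preimage unfolding fun_morphism_def top by blast
    then have "closedin (zariski N) {z \<in> Z. \<psi> z \<in> A}"
      using Z closedin_trans_full by (metis points)
    then obtain S where S: "S \<subseteq> poly_funs N" "{z \<in> Z. \<psi> z \<in> A} = zero_set N S"
      unfolding closedin_zariski by blast
    have "x \<in> A \<longleftrightarrow> (\<forall>p\<in>S. p (\<phi> x) = 0)" if x: "x \<in> points X" for x
    proof -
      have "\<phi> x \<in> Z" using fun_morphism_in_points[OF \<phi> x] by (simp add: points)
      then have "x \<in> A \<longleftrightarrow> \<phi> x \<in> zero_set N S" using inv(1) x by (simp flip: S(2))
      then show ?thesis using \<open>\<phi> x \<in> Z\<close> Z_sub by (auto simp: zero_set_def)
    qed
    with S(1) show ?thesis by blast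
  qed
  obtain f where "\<forall>i<n. f i \<in> poly_funs N" "alg_independent_on (\<phi> ` C n) n f"
    using alg_independent_on_irreducible_chain[OF cont closed chain] by blast
  then have growth_C: "has_growth N (\<phi> ` C n) n"
    by (intro alg_independent_on_imp_growth) blast+
  have "C n \<subseteq> points X"
    using chain by (simp add: irreducible_chain_def irreducible_closed_def closedin_subset)
  then have "\<phi> ` C n \<subseteq> Z" using fun_morphism_in_points[OF \<phi>] points by blast
  with growth_C have "has_growth N Z n" by (rule has_growth_mono)
  then obtain G where G: "\<forall>i<n. G i \<in> poly_funs N"
    "\<forall>y\<in>affine_points n. \<exists>z\<in>Z. \<forall>i<n. G i z = y i"
    using noether_normalization[OF Z] by blast
  define g where "g = (\<lambda>x. \<lambda>i\<in>{..<n}. G i (\<phi> x))"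
  have g: "fun_morphism X (affine_space n) g"
    unfolding g_def by (rule fun_morphism_compose[OF \<phi> fun_morphism_poly_map]) (use G(1) in blast)
  moreover have "y \<in> g ` points X" if y: "y \<in> points (affine_space n)" for y
  proof -
    have y': "y \<in> affine_points n" using y by (simp add: top_of_affine_space topspace_zariski)
    then obtain z where z: "z \<in> Z" "\<forall>i<n. G i z = y i" using G(2) by blast
    have "\<phi> (\<psi> z) = z" using inv(2) z(1) by (simp add: points)
    then have "g (\<psi> z) i = y i" for i
      using z(2) y' by (cases "i < n") (auto simp: g_def affine_points_def PiE_def extensional_def)
    then have "g (\<psi> z) = y" by (rule ext)
    moreover have "\<psi> z \<in> points X" using fun_morphism_in_points[OF \<psi>] z(1) points by blast
    ultimately show ?thesis by blast
  qed
  ultimately show ?thesis using that fun_morphism_in_points[OF g] by blast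
qed

theorem proposition1p6:
  fixes X :: "('a, 'k::{alg_closed_field, field_char_0}) fun_space"
    and Y :: "('b, 'k) fun_space"
    and f :: "(nat \<Rightarrow> 'k) \<Rightarrow> 'b"
    and n :: nat
  assumes "affine_variety X"
    and "has_dimension (top_of X) n"
    and "variety Y"
    and "fun_morphism (affine_space n) Y f"
    and "f ` points (affine_space n) = points Y"
  shows "\<exists>\<phi>. fun_morphism X Y \<phi> \<and> \<phi> ` points X = points Y \<and>
           (\<exists>g h. fun_morphism X (affine_space n) g \<and> fun_morphism (affine_space n) Y h \<and>
                  (\<forall>x\<in>points X. \<phi> x = h (g x)))"
proof -
  obtain g where g: "fun_morphism X (affine_space n) g" "g ` points X = points (affine_space n)"
    using affine_variety_surjects_onto_affine_space[OF assms(1,2)] .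
  have "(\<lambda>x. f (g x)) ` points X = points Y"
    using assms(5) g(2) by (simp add: image_image[symmetric])
  with fun_morphism_compose[OF g(1) assms(4)] g(1) assms(4) show ?thesis by blast
qed

end
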